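(* The categories of poc sets and Stone median algebras are anti equivalent (via the functors $P\mapsto P^\circ$ and $M\mapsto M^\bullet$). The evaluation maps $ev: P\to P^{\circ\bullet}$, $ev(a)=\{U\in P^\circ\mid a\in U\}$, and $ev: M\to M^{\bullet\circ}$, $ev(x)=\{H\in M^\bullet\mid x\in H\}$, induce isomorphisms of poc sets and Stone median algebras, respectively, for every poc set $P$ and every Stone median algebra $M$.
   Context: A poc set is a partially ordered set $P$ with a smallest element $0$ and an involution $^*$ such that $a\le b\Rightarrow b^*\le a^*$, and $a\le a^*\Rightarrow a=0$; standing convention: $0\neq 0^*$. A poc morphism is a monotone map fixing $0$ and commuting with $^*$. $\mathbf{2}=\{0,1\}$ is a poc set with $0<1$, $0^*=1$. A median algebra is a set $M$ (standing convention: nonempty) with a map $m: M^3\to M$ such that: $m(x,y,z)=m(x,z,y)=m(y,z,x)$; $m(x,x,y)=x$; $m(m(x,y,z),u,v)=m(x,m(y,u,v),m(z,u,v))$. A median morphism is a map preserving $m$. $\mathbf{2}$ carries its unique median structure (majority) and the discrete topology. A subset $C$ is convex if $m(x,y,z)\in C$ for all $x,y\in C$, $z\in M$; a half space is a subset $H$ with $H$ and $M\setminus H$ both convex. A Stone space is a compact Hausdorff totally disconnected space. A Stone median algebra is a median algebra with a Stone topology such that $m: M\times M\times M\to M$ is continuous; morphisms are continuous median morphisms. An ultra filter in a poc set $P$ is an upper set $U\subset P$ such that $P$ is the disjoint union of $U$ and $U^*=\{a^*: a\in U\}$; ultra filters are exactly the supports $f^{-1}(1)$ of poc morphisms $f: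 P\to\mathbf{2}$. $P^\circ$ is the set of ultra filters of $P$ (equivalently of poc morphisms $P\to\mathbf{2}$) with the Boolean median $m(U,V,W)=(U\cap V)\cup(V\cap W)\cup(W\cap U)$ and the (Stone) topology with subbasis $\{V(a): a\in P\}$, $V(a)=\{U\in P^\circ: a\in U\}$; it is a Stone median algebra. For a Stone median algebra $M$, $M^\bullet$ is the set of clopen half spaces of $M$ (equivalently, continuous median morphisms $M\to\mathbf{2}$), a poc set under inclusion with $H^*=M\setminus H$ and $0=\varnothing$. Both constructions act on morphisms by taking preimages. *)

theory Defs
  imports "HOL-Analysis.Analysis"
begin

section \<open>Poc sets\<close>

record 'a poc =
  poc_carrier :: "'a set"
  poc_le :: "'a rel"
  poc_zero :: 'a
  poc_star :: "'a \<Rightarrow> 'a"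

locale poc_set =
  fixes P :: "'a poc"
  assumes partial_order: "partial_order_on (poc_carrier P) (poc_le P)"
    and zero_closed: "poc_zero P \<in> poc_carrier P"
    and zero_least: "a \<in> poc_carrier P \<Longrightarrow> (poc_zero P, a) \<in> poc_le P"
    and star_closed: "a \<in> poc_carrier P \<Longrightarrow> poc_star P a \<in> poc_carrier P"
    and star_star: "a \<in> poc_carrier P \<Longrightarrow> poc_star P (poc_star P a) = a"
    and star_antimono: "(a, b) \<in> poc_le P \<Longrightarrow> (poc_star P b, poc_star P a) \<in> poc_le P"
    and le_star_imp_zero: "(a, poc_star P a) \<in> poc_le P \<Longrightarrow> a = poc_zero P"
    and zero_neq_star_zero: "poc_zero P \<noteq> poc_star P (poc_zero P)"

text \<open>
  Morphisms of both categories are extensional functions (undefined outside the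
  carrier of the domain), so that equality of morphisms is equality of functions. The
  identity morphism on \<open>A\<close> is then \<open>\<lambda>x\<in>A. x\<close> and composition is \<^const>\<open>compose\<close>.
\<close>

definition poc_hom :: "'a poc \<Rightarrow> 'b poc \<Rightarrow> ('a \<Rightarrow> 'b) set" where
  "poc_hom P Q = {f \<in> poc_carrier P \<rightarrow>\<^sub>E poc_carrier Q.
     (\<forall>a b. (a, b) \<in> poc_le P \<longrightarrow> (f a, f b) \<in> poc_le Q) \<and>
     f (poc_zero P) = poc_zero Q \<and>
     (\<forall>a\<in>poc_carrier P. f (poc_star P a) = poc_star Q (f a))}"

definition poc_id :: "'a poc \<Rightarrow> 'a \<Rightarrow> 'a" where
  "poc_id P = (\<lambda>a\<in>poc_carrier P. a)"

definition poc_iso :: "'a poc \<Rightarrow> 'b poc \<Rightarrow> ('a \<Rightarrow> 'b) set" where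
  "poc_iso P Q = {f \<in> poc_hom P Q. \<exists>g\<in>poc_hom Q P.
     compose (poc_carrier P) g f = poc_id P \<and> compose (poc_carrier Q) f g = poc_id Q}"

lemma poc_id_hom: "poc_set P \<Longrightarrow> poc_id P \<in> poc_hom P P"
  using poc_set.partial_order[of P]
  by (auto simp: poc_id_def poc_hom_def poc_set.zero_closed poc_set.star_closed
      dest: partial_order_onD(4))

lemma poc_compose_hom:
  assumes "poc_set P" "f \<in> poc_hom P Q" "g \<in> poc_hom Q R"
  shows "compose (poc_carrier P) g f \<in> poc_hom P R"
proof -
  have "a \<in> poc_carrier P \<and> b \<in> poc_carrier P" if "(a, b) \<in> poc_le P" for a b
    using that poc_set.partial_order[OF assms(1)] by (auto dest: partial_order_onD(4))
  then show ?thesis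
    using assms by (auto simp: poc_hom_def compose_def PiE_iff poc_set.zero_closed poc_set.star_closed)
qed


section \<open>Stone median algebras\<close>

locale median_algebra =
  fixes M :: "'a set" and m :: "'a \<Rightarrow> 'a \<Rightarrow> 'a \<Rightarrow> 'a"
  assumes nonempty: "M \<noteq> {}"
    and med_closed: "\<lbrakk>x \<in> M; y \<in> M; z \<in> M\<rbrakk> \<Longrightarrow> m x y z \<in> M"
    and med_swap: "\<lbrakk>x \<in> M; y \<in> M; z \<in> M\<rbrakk> \<Longrightarrow> m x y z = m x z y"
    and med_rotate: "\<lbrakk>x \<in> M; y \<in> M; z \<in> M\<rbrakk> \<Longrightarrow> m x y z = m y z x"
    and med_idem: "\<lbrakk>x \<in> M; y \<in> M\<rbrakk> \<Longrightarrow> m x x y = x"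
    and med_distrib: "\<lbrakk>x \<in> M; y \<in> M; z \<in> M; u \<in> M; v \<in> M\<rbrakk> \<Longrightarrow>
           m (m x y z) u v = m x (m y u v) (m z u v)"

definition median_convex :: "'a set \<Rightarrow> ('a \<Rightarrow> 'a \<Rightarrow> 'a \<Rightarrow> 'a) \<Rightarrow> 'a set \<Rightarrow> bool" where
  "median_convex M m C \<longleftrightarrow> C \<subseteq> M \<and> (\<forall>x\<in>C. \<forall>y\<in>C. \<forall>z\<in>M. m x y z \<in> C)"

definition half_space :: "'a set \<Rightarrow> ('a \<Rightarrow> 'a \<Rightarrow> 'a \<Rightarrow> 'a) \<Rightarrow> 'a set \<Rightarrow> bool" where
  "half_space M m H \<longleftrightarrow> H \<subseteq> M \<and> median_convex M m H \<and> median_convex M m (M - H)"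

definition totally_disconnected_space :: "'a topology \<Rightarrow> bool" where
  "totally_disconnected_space X \<longleftrightarrow>
     (\<forall>C. connectedin X C \<longrightarrow> (\<forall>x\<in>C. \<forall>y\<in>C. x = y))"

definition Stone_space :: "'a topology \<Rightarrow> bool" where
  "Stone_space X \<longleftrightarrow> compact_space X \<and> Hausdorff_space X \<and> totally_disconnected_space X"

text \<open>The underlying set is the \<^const>\<open>topspace\<close> of the topology.\<close>

record 'a topological_median =
  sma_top :: "'a topology"
  sma_med :: "'a \<Rightarrow> 'a \<Rightarrow> 'a \<Rightarrow> 'a"

abbreviation sma_carrier :: "'a topological_median \<Rightarrow> 'a set" where
  "sma_carrier M \<equiv> topspace (sma_top M)"

locale stone_median_algebra =
  fixes M :: "'a topological_median"
  assumes median_algebra: "median_algebra (sma_carrier M) (sma_med M)"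
    and Stone_space: "Stone_space (sma_top M)"
    and continuous_med: "continuous_map
          (prod_topology (sma_top M) (prod_topology (sma_top M) (sma_top M))) (sma_top M)
          (\<lambda>(x, y, z). sma_med M x y z)"

definition sma_hom :: "'a topological_median \<Rightarrow> 'b topological_median \<Rightarrow> ('a \<Rightarrow> 'b) set" where
  "sma_hom M N = {f \<in> sma_carrier M \<rightarrow>\<^sub>E sma_carrier N.
     continuous_map (sma_top M) (sma_top N) f \<and>
     (\<forall>x\<in>sma_carrier M. \<forall>y\<in>sma_carrier M. \<forall>z\<in>sma_carrier M.
        f (sma_med M x y z) = sma_med N (f x) (f y) (f z))}"

definition sma_id :: "'a topological_median \<Rightarrow> 'a \<Rightarrow> 'a" where
  "sma_id M = (\<lambda>x\<in>sma_carrier M. x)"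

definition sma_iso :: "'a topological_median \<Rightarrow> 'b topological_median \<Rightarrow> ('a \<Rightarrow> 'b) set" where
  "sma_iso M N = {f \<in> sma_hom M N. \<exists>g\<in>sma_hom N M.
     compose (sma_carrier M) g f = sma_id M \<and> compose (sma_carrier N) f g = sma_id N}"

lemma sma_id_hom:
  assumes "stone_median_algebra M"
  shows "sma_id M \<in> sma_hom M M"
proof -
  interpret median_algebra "sma_carrier M" "sma_med M"
    using assms by (rule stone_median_algebra.median_algebra)
  have "continuous_map (sma_top M) (sma_top M) (sma_id M)"
    by (rule continuous_map_eq[OF continuous_map_id]) (simp add: sma_id_def)
  then show ?thesis
    by (auto simp: sma_id_def sma_hom_def med_closed)
qed

lemma sma_compose_hom:
  assumes "stone_median_algebra M" "f \<in> sma_hom M N" "g \<in> sma_hom N K"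
  shows "compose (sma_carrier M) g f \<in> sma_hom M K"
proof -
  interpret median_algebra "sma_carrier M" "sma_med M"
    using assms(1) by (rule stone_median_algebra.median_algebra)
  have "continuous_map (sma_top M) (sma_top K) (g \<circ> f)"
    using assms by (auto simp: sma_hom_def intro: continuous_map_compose)
  then have "continuous_map (sma_top M) (sma_top K) (compose (sma_carrier M) g f)"
    by (rule continuous_map_eq) (simp add: compose_def)
  then show ?thesis
    using assms(2,3) by (auto simp: sma_hom_def compose_def PiE_iff med_closed)
qed


section \<open>The dual of a poc set\<close>

definition ultra_filters :: "'a poc \<Rightarrow> 'a set set" where
  "ultra_filters P = {U. U \<subseteq> poc_carrier P \<and>
     (\<forall>a\<in>U. \<forall>b\<in>poc_carrier P. (a, b) \<in> poc_le P \<longrightarrow> b \<in> U) \<and>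
     U \<union> poc_star P ` U = poc_carrier P \<and> U \<inter> poc_star P ` U = {}}"

definition poc_dual :: "'a poc \<Rightarrow> 'a set topological_median" where
  "poc_dual P =
     \<lparr>sma_top = topology_generated_by {{U \<in> ultra_filters P. a \<in> U} | a. a \<in> poc_carrier P},
      sma_med = (\<lambda>U V W. (U \<inter> V) \<union> (V \<inter> W) \<union> (W \<inter> U))\<rparr>"

lemma sma_carrier_poc_dual:
  assumes "poc_set P"
  shows "sma_carrier (poc_dual P) = ultra_filters P"
proof -
  interpret poc_set P by fact
  have "\<exists>a\<in>poc_carrier P. a \<in> U" if "U \<in> ultra_filters P" for U
    using that zero_closed unfolding ultra_filters_def by fastforce
  then have "(\<Union>a\<in>poc_carrier P. {U \<in> ultra_filters P. a \<in> U}) = ultra_filters P"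
    by blast
  then show ?thesis
    by (simp add: poc_dual_def Setcompr_eq_image)
qed

definition poc_dual_map :: "'a poc \<Rightarrow> 'b poc \<Rightarrow> ('a \<Rightarrow> 'b) \<Rightarrow> 'b set \<Rightarrow> 'a set" where
  "poc_dual_map P Q f = (\<lambda>V\<in>ultra_filters Q. {a \<in> poc_carrier P. f a \<in> V})"


section \<open>The dual of a Stone median algebra\<close>

definition clopen_half_spaces :: "'a topological_median \<Rightarrow> 'a set set" where
  "clopen_half_spaces M = {H. openin (sma_top M) H \<and> closedin (sma_top M) H \<and>
     half_space (sma_carrier M) (sma_med M) H}"

definition sma_dual :: "'a topological_median \<Rightarrow> 'a set poc" where
  "sma_dual M =
     \<lparr>poc_carrier = clopen_half_spaces M,
      poc_le = {(H, K). H \<in> clopen_half_spaces M \<and> K \<in> clopen_half_spaces M \<and> H \<subseteq> K},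
      poc_zero = {},
      poc_star = (\<lambda>H. sma_carrier M - H)\<rparr>"

definition sma_dual_map ::
  "'a topological_median \<Rightarrow> 'b topological_median \<Rightarrow> ('a \<Rightarrow> 'b) \<Rightarrow> 'b set \<Rightarrow> 'a set" where
  "sma_dual_map M N f = (\<lambda>H\<in>clopen_half_spaces N. {x \<in> sma_carrier M. f x \<in> H})"


section \<open>Evaluation maps\<close>

definition poc_ev :: "'a poc \<Rightarrow> 'a \<Rightarrow> 'a set set" where
  "poc_ev P = (\<lambda>a\<in>poc_carrier P. {U \<in> ultra_filters P. a \<in> U})"

definition sma_ev :: "'a topological_median \<Rightarrow> 'a \<Rightarrow> 'a set set" where
  "sma_ev M = (\<lambda>x\<in>sma_carrier M. {H \<in> clopen_half_spaces M. x \<in> H})"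

end

theory Submission
  imports Defs
begin

text \<open>
  The functors act by preimages, so functoriality and naturality are formal. The content is
  that both evaluation maps are isomorphisms, and each half rests on one separation result.

  \<^bold>\<open>Poc sets.\<close> A subset of a poc set is contained in an ultra filter if and only if it contains
  no two elements, equal or distinct, with \<open>a \<le> b\<^sup>*\<close>
  (\<open>consistent_extends_to_ultra_filter\<close>). All obstructions thus involve pairs only. Applied to
  \<open>{a, b\<^sup>*}\<close> this shows that evaluation reflects the order. Applied to
  the elements \<open>a\<^sup>*\<close> for a covering family of subbasic sets \<open>V(a)\<close>, it shows that two members
  of the family suffice, and the dual is compact by Alexander's theorem. For surjectivity, a closed convex set of ultra filters is an intersection of
  subbasic sets; if a clopen half space and its complement are both written in this way, then
  the elements involved are inconsistent, and the inconsistent pair exhibits the half space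
  as a subbasic set (\<open>clopen_half_space_eq_basic_open\<close>).

  \<^bold>\<open>Stone median algebras.\<close> Surjectivity is Helly's theorem for convex sets together with
  compactness. Injectivity says that clopen half spaces separate points. In an arbitrary
  median algebra half spaces separate points, by taking a maximal convex set that contains
  one point and avoids the other (\<open>half_space_separation\<close>). For the clopen version, a clopen
  set separating the two points has a syntactic congruence with open classes, and a
  half space of the quotient pulls back to a clopen one (\<open>clopen_half_space_separation\<close>). A
  continuous bijective morphism from a compact to a Hausdorff algebra is then an isomorphism.
\<close>

section \<open>Half spaces in median algebras\<close>

context median_algebra
begin

lemma med_left_swap: "\<lbrakk>x \<in> M; y \<in> M; z \<in> M\<rbrakk> \<Longrightarrow> m x y z = m y x z"
  by (simp add: med_rotate[of x y z] med_swap[of y z x])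

lemmas med_perm = med_swap med_left_swap

lemma med_absorb: "\<lbrakk>x \<in> M; y \<in> M\<rbrakk> \<Longrightarrow> m y x x = x"
  by (simp add: med_rotate[of y x x] med_idem)

lemma med_absorb_outer: "\<lbrakk>x \<in> M; y \<in> M\<rbrakk> \<Longrightarrow> m x y x = x"
  by (simp add: med_swap[of x y x] med_idem)

lemma med_distrib_left:
  assumes "y \<in> M" "s \<in> M" "p \<in> M" "q \<in> M" "r \<in> M"
  shows "m y s (m p q r) = m (m y s p) (m y s q) r"
  using med_distrib[of r p q y s] assms by (simp add: med_closed med_perm)

text \<open>
  For a fixed base point \<open>z\<close> the operation \<open>\<lambda>a b. m z a b\<close> is a meet with least element
  \<open>z\<close>: it is idempotent and commutative by the axioms, and associative by the following
  lemma. The computations below are semilattice computations for a suitable base point.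
\<close>

lemma meet_assoc:
  assumes "z \<in> M" "a \<in> M" "b \<in> M" "c \<in> M"
  shows "m z (m z a b) c = m z a (m z b c)"
  using med_distrib[of a b z c z] assms by (simp add: med_closed med_perm med_absorb med_absorb_outer med_idem)

lemma med_between:
  assumes "x \<in> M" "y \<in> M" "w \<in> M"
  shows "m x y (m x y w) = m x y w"
  using med_distrib_left[of x y x y w] assms by (simp add: med_idem med_absorb med_absorb_outer)

text \<open>
  If \<open>t\<close> lies between \<open>h\<close> and \<open>p\<close>, then \<open>h \<and> p \<le> t\<close> in the semilattice based at any \<open>z\<close>.
\<close>

lemma meet_le_of_between:
  assumes "z \<in> M" "h \<in> M" "p \<in> M" "t \<in> M" and "m h p t = t"
  shows "m z (m z h p) t = m z h p"
  using med_distrib[of z z t h p] assms by (simp add: med_closed med_perm med_idem med_absorb)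

lemma meet_interchange:
  assumes "z \<in> M" "a \<in> M" "b \<in> M" "c \<in> M" "d \<in> M"
  shows "m z (m z a b) (m z c d) = m z (m z a c) (m z b d)"
proof -
  have "m z (m z a b) (m z c d) = m z a (m z (m z b c) d)"
    using assms by (simp add: med_closed meet_assoc)
  also have "\<dots> = m z a (m z (m z c b) d)"
    using assms by (simp add: med_swap[of z b c])
  also have "\<dots> = m z (m z a c) (m z b d)"
    using assms by (simp add: med_closed meet_assoc)
  finally show ?thesis .
qed

text \<open>
  This describes the convex hull of \<open>H\<close> and \<open>p\<close> as a union of intervals. If \<open>z1\<close> and
  \<open>z2\<close> lie on intervals ending in \<open>h1\<close> and \<open>h2\<close>, then any \<open>z\<close> between \<open>z1\<close> and \<open>z2\<close> lies on
  the interval ending in \<open>m h1 h2 z\<close>. In the semilattice based at \<open>z\<close> this says that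
  \<open>h1 \<and> h2 \<and> p\<close> is the least element, which holds because
  \<open>(h1 \<and> p) \<and> (h2 \<and> p) \<le> z1 \<and> z2 = z\<close>.
\<close>

lemma convex_join_point:
  assumes H: "median_convex M m H" and p: "p \<in> M"
  shows "median_convex M m {z \<in> M. \<exists>h\<in>H. m h p z = z}"
  unfolding median_convex_def
proof (intro conjI ballI)
  fix z1 z2 w
  assume "z1 \<in> {z \<in> M. \<exists>h\<in>H. m h p z = z}" "z2 \<in> {z \<in> M. \<exists>h\<in>H. m h p z = z}" and w: "w \<in> M"
  then obtain h1 h2 where z: "z1 \<in> M" "z2 \<in> M" and h: "h1 \<in> H" "h2 \<in> H"
    and eq: "m h1 p z1 = z1" "m h2 p z2 = z2" by blast
  define z where "z = m z1 z2 w"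
  have hM: "h1 \<in> M" "h2 \<in> M" using H h by (auto simp: median_convex_def)
  have zM: "z \<in> M" using z w by (simp add: z_def med_closed)
  have "m z1 z2 z = z" using z w unfolding z_def by (rule med_between)
  then have z12: "m z z1 z2 = z" using z zM by (simp add: med_rotate[of z z1 z2])
  define g1 where "g1 = m z h1 p"
  define g2 where "g2 = m z h2 p"
  have gM: "g1 \<in> M" "g2 \<in> M" using hM zM p by (auto simp: g1_def g2_def med_closed)
  have le: "m z g1 z1 = g1" "m z g2 z2 = g2"
    unfolding g1_def g2_def using meet_le_of_between zM hM p z eq by auto
  have "m z g1 g2 = m z (m z g1 z1) (m z g2 z2)" by (simp add: le)
  also have "\<dots> = m z (m z g1 g2) (m z z1 z2)"
    using zM gM z by (simp add: meet_interchange)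
  also have "\<dots> = z"
    using z12 zM gM by (simp add: med_closed med_absorb_outer)
  finally have "m z g1 g2 = z" .
  then have "m z (m z h1 h2) p = z"
    using meet_interchange[of z h1 p h2 p] zM hM p by (simp add: g1_def g2_def med_absorb)
  then have "m (m h1 h2 z) p z = z"
    using zM hM p by (simp add: med_closed med_rotate[of z])
  moreover have "m h1 h2 z \<in> H"
    using H h zM by (auto simp: median_convex_def)
  ultimately show "m z1 z2 w \<in> {z \<in> M. \<exists>h\<in>H. m h p z = z}"
    using zM unfolding z_def by blast
qed blast

text \<open>
  A convex set \<open>H\<close> that is maximal among those containing \<open>x\<close> and avoiding \<open>y\<close> is a half
  space. By maximality the join of \<open>H\<close> with any outside point \<open>p\<close> contains \<open>y\<close>, so \<open>y\<close> lies
  between \<open>p\<close> and some point of \<open>H\<close>. Suppose that \<open>p\<close> and \<open>q\<close> are outside, with witnesses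
  \<open>h\<close> and \<open>k\<close> in \<open>H\<close>, and that some \<open>r\<close> between \<open>p\<close> and \<open>q\<close> is in \<open>H\<close>. In the semilattice
  based at \<open>y\<close> the element \<open>s = h \<and> k\<close> is disjoint from \<open>p\<close> and from \<open>q\<close>, hence from \<open>r\<close>.
  So \<open>y = m y s r\<close> with \<open>s\<close> and \<open>r\<close> in \<open>H\<close>, which puts \<open>y\<close> into \<open>H\<close>.
\<close>

lemma half_space_separation:
  assumes x: "x \<in> M" and y: "y \<in> M" and "x \<noteq> y"
  obtains H where "half_space M m H" "x \<in> H" "y \<notin> H"
proof -
  define \<A> where "\<A> = {H. median_convex M m H \<and> x \<in> H \<and> y \<notin> H}"
  have "\<exists>H\<in>\<A>. \<forall>X\<in>\<A>. H \<subseteq> X \<longrightarrow> X = H"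
  proof (rule subset_Zorn_nonempty)
    have "{x} \<in> \<A>"
      using assms by (auto simp: \<A>_def median_convex_def med_idem)
    then show "\<A> \<noteq> {}" by blast
  next
    fix \<C> assume ne: "\<C> \<noteq> {}" and ch: "subset.chain \<A> \<C>"
    then have sub: "\<C> \<subseteq> \<A>" and lin: "\<And>A B. A \<in> \<C> \<Longrightarrow> B \<in> \<C> \<Longrightarrow> A \<subseteq> B \<or> B \<subseteq> A"
      by (auto simp: subset_chain_def)
    have "m a b c \<in> \<Union>\<C>" if ab: "a \<in> \<Union>\<C>" "b \<in> \<Union>\<C>" and "c \<in> M" for a b c
    proof -
      obtain A B where "A \<in> \<C>" "a \<in> A" "B \<in> \<C>" "b \<in> B" using ab by auto
      then obtain D where "D \<in> \<C>" "a \<in> D" "b \<in> D" using lin by blast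
      moreover have "median_convex M m D" using sub \<open>D \<in> \<C>\<close> by (auto simp: \<A>_def)
      ultimately show ?thesis using \<open>c \<in> M\<close> by (auto simp: median_convex_def intro!: bexI[of _ D])
    qed
    moreover have "\<Union>\<C> \<subseteq> M" using sub by (auto simp: \<A>_def median_convex_def)
    ultimately show "\<Union>\<C> \<in> \<A>" using sub ne by (auto simp: \<A>_def median_convex_def)
  qed
  then obtain H where "H \<in> \<A>" and max: "\<And>X. X \<in> \<A> \<Longrightarrow> H \<subseteq> X \<Longrightarrow> X = H" by blast
  then have H: "median_convex M m H" and xH: "x \<in> H" and yH: "y \<notin> H" by (auto simp: \<A>_def)
  have HM: "H \<subseteq> M" using H by (simp add: median_convex_def)
  have reach: "\<exists>h\<in>H. m h p y = y" if p: "p \<in> M - H" for p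
  proof (rule ccontr)
    assume no: "\<not> ?thesis"
    let ?J = "{z \<in> M. \<exists>h\<in>H. m h p z = z}"
    have "h \<in> ?J" if "h \<in> H" for h
      using that HM p by (auto intro!: bexI[of _ h] simp: med_absorb_outer)
    moreover have "p \<in> ?J"
      using xH x p by (auto intro!: bexI[of _ x] simp: med_absorb)
    moreover have "?J \<in> \<A>"
      using convex_join_point[OF H] p no xH calculation(1) by (auto simp: \<A>_def)
    ultimately show False using max[of ?J] p by blast
  qed
  have "median_convex M m (M - H)"
    unfolding median_convex_def
  proof (intro conjI ballI)
    fix p q w assume p: "p \<in> M - H" and q: "q \<in> M - H" and w: "w \<in> M"
    define r where "r = m p q w"
    have rM: "r \<in> M" using p q w by (simp add: r_def med_closed)
    have "r \<notin> H"
    proof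
      assume r: "r \<in> H"
      obtain h k where h: "h \<in> H" "m h p y = y" and k: "k \<in> H" "m k q y = y"
        using reach p q by blast
      have hk: "h \<in> M" "k \<in> M" and pq: "p \<in> M" "q \<in> M" using h k HM p q by auto
      define s where "s = m y h k"
      have s: "s \<in> M" using hk y by (simp add: s_def med_closed)
      have yhp: "m y h p = y" "m y k q = y" using h k hk pq y by (simp_all add: med_rotate[of y])
      have "m y s p = m y k (m y h p)"
        unfolding s_def using hk pq y by (simp add: med_swap[of y h k] meet_assoc)
      then have sp: "m y s p = y" using yhp hk y by (simp add: med_absorb_outer)
      have "m y s q = m y h (m y k q)"
        unfolding s_def using hk pq y by (simp add: meet_assoc)
      then have sq: "m y s q = y" using yhp hk y by (simp add: med_absorb_outer)
      have "m y s r = m y y w"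
        unfolding r_def using med_distrib_left[OF y s pq w] sp sq by simp
      then have "m y s r = y" using y w by (simp add: med_idem)
      moreover have "m h k y \<in> H" using H h k y by (auto simp: median_convex_def)
      then have "s \<in> H" unfolding s_def using hk y by (simp add: med_rotate[of y])
      then have "m s r y \<in> H" using H r y by (auto simp: median_convex_def)
      then have "m y s r \<in> H" using s rM y by (simp add: med_rotate[of y])
      ultimately show False using yH by simp
    qed
    then show "m p q w \<in> M - H" using rM by (simp add: r_def)
  qed blast
  then show thesis using that[of H] H xH yH HM by (simp add: half_space_def)
qed

text \<open>
  The median of one point from each pairwise intersection lies in all three sets.
\<close>

lemma convex_Int_three:
  assumes conv: "median_convex M m A" "median_convex M m B" "median_convex M m C"
    and meet: "A \<inter> B \<noteq> {}" "A \<inter> C \<noteq> {}" "B \<inter> C \<noteq> {}"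
  shows "A \<inter> B \<inter> C \<noteq> {}"
proof -
  obtain x y z where xyz: "x \<in> A" "x \<in> B" "y \<in> A" "y \<in> C" "z \<in> B" "z \<in> C"
    using meet by blast
  have M: "x \<in> M" "y \<in> M" "z \<in> M" using xyz conv by (auto simp: median_convex_def)
  have "m x y z \<in> A" "m x z y \<in> B" "m y z x \<in> C"
    using conv xyz M by (auto simp: median_convex_def)
  moreover have "m x z y = m x y z" "m y z x = m x y z"
    using M by (simp_all add: med_perm)
  ultimately show ?thesis by auto
qed

text \<open>
  Intersecting all members with one of them keeps the family pairwise intersecting, by the
  case of three sets, and so reduces its size by one.
\<close>

lemma Helly:
  assumes "finite I" "I \<noteq> {}" "\<And>i. i \<in> I \<Longrightarrow> median_convex M m (C i)"
    and "\<And>i j. i \<in> I \<Longrightarrow> j \<in> I \<Longrightarrow> C i \<inter> C j \<noteq> {}"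
  shows "(\<Inter>i\<in>I. C i) \<noteq> {}"
  using assms
proof (induction arbitrary: C rule: finite_ne_induct)
  case (insert k I)
  have "(\<Inter>i\<in>I. C i \<inter> C k) \<noteq> {}"
  proof (rule insert.IH)
    fix i assume "i \<in> I"
    then show "median_convex M m (C i \<inter> C k)"
      using insert.prems(1)[of i] insert.prems(1)[of k] by (auto simp: median_convex_def)
  next
    fix i j assume "i \<in> I" "j \<in> I"
    then have "C i \<inter> C j \<inter> C k \<noteq> {}"
      by (intro convex_Int_three insert.prems) auto
    then show "C i \<inter> C k \<inter> (C j \<inter> C k) \<noteq> {}" by blast
  qed
  then show ?case using \<open>I \<noteq> {}\<close> by auto
qed auto

end

lemma median_algebra_image:
  assumes "median_algebra M m" and f: "f ` M = N"
    and hom: "\<And>x y z. \<lbrakk>x \<in> M; y \<in> M; z \<in> M\<rbrakk> \<Longrightarrow> f (m x y z) = n (f x) (f y) (f z)"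
  shows "median_algebra N n"
proof -
  interpret median_algebra M m by fact
  show ?thesis
  proof
    show "N \<noteq> {}" using nonempty f by blast
  next
    fix x y z assume "x \<in> N" "y \<in> N" "z \<in> N"
    then show "n x y z \<in> N" unfolding f[symmetric] by (auto simp flip: hom simp: med_closed)
  next
    fix x y z assume "x \<in> N" "y \<in> N" "z \<in> N"
    then show "n x y z = n x z y" unfolding f[symmetric] by (auto simp flip: hom simp: med_swap)
  next
    fix x y z assume "x \<in> N" "y \<in> N" "z \<in> N"
    then show "n x y z = n y z x" unfolding f[symmetric] by (auto simp flip: hom simp: med_perm)
  next
    fix x y assume "x \<in> N" "y \<in> N"
    then show "n x x y = x" unfolding f[symmetric] by (auto simp flip: hom simp: med_idem)
  next
    fix x y z u v assume "x \<in> N" "y \<in> N" "z \<in> N" "u \<in> N" "v \<in> N"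
    then show "n (n x y z) u v = n x (n y u v) (n z u v)"
      unfolding f[symmetric] by (auto simp flip: hom simp: med_closed med_distrib)
  qed
qed

lemma half_space_vimage:
  assumes K: "half_space N n K" and f: "f ` M \<subseteq> N"
    and closed: "\<And>x y z. \<lbrakk>x \<in> M; y \<in> M; z \<in> M\<rbrakk> \<Longrightarrow> m x y z \<in> M"
    and hom: "\<And>x y z. \<lbrakk>x \<in> M; y \<in> M; z \<in> M\<rbrakk> \<Longrightarrow> f (m x y z) = n (f x) (f y) (f z)"
  shows "half_space M m {x \<in> M. f x \<in> K}"
proof -
  have "median_convex M m {x \<in> M. f x \<in> L}" if "median_convex N n L" for L
    using that f by (auto simp: median_convex_def closed hom)
  from this[of K] this[of "N - K"] have "median_convex M m {x \<in> M. f x \<in> K}"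
    "median_convex M m {x \<in> M. f x \<in> N - K}"
    using K by (auto simp: half_space_def)
  moreover have "{x \<in> M. f x \<in> N - K} = M - {x \<in> M. f x \<in> K}" using f by blast
  ultimately show ?thesis by (auto simp: half_space_def)
qed

section \<open>Clopen half spaces\<close>

text \<open>
  In a compact Hausdorff space the quasi-components, which are the intersections of the
  clopen sets around a point, coincide with the connected components.
\<close>

lemma Stone_space_clopen_separation:
  assumes X: "Stone_space X" and x: "x \<in> topspace X" and y: "y \<in> topspace X" and "x \<noteq> y"
  obtains C where "openin X C" "closedin X C" "x \<in> C" "y \<notin> C"
proof -
  have "\<not> connected_component_of X x y"
    using X \<open>x \<noteq> y\<close> unfolding Stone_space_def totally_disconnected_space_def connected_component_of_def
    by blast
  moreover have "quasi_component_of X x = connected_component_of X x"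
    using X by (intro quasi_eq_connected_component_of) (auto simp: Stone_space_def)
  ultimately have "\<not> quasi_component_of X x y" by simp
  then show thesis using that x y unfolding quasi_component_of by blast
qed

text \<open>
  The points whose slice differs from that at \<open>x\<close> form the projection of a closed set, and
  projecting along a compact factor is a closed map. So the slices of a clopen set are
  locally constant.
\<close>

lemma openin_same_slice:
  assumes Y: "compact_space Y" and D: "openin (prod_topology X Y) D" "closedin (prod_topology X Y) D"
    and x: "x \<in> topspace X"
  shows "openin X {x' \<in> topspace X. \<forall>y\<in>topspace Y. (x', y) \<in> D \<longleftrightarrow> (x, y) \<in> D}" (is "openin X ?S")
proof -
  define S where "S = {y \<in> topspace Y. (x, y) \<in> D}"
  have cont: "continuous_map Y (prod_topology X Y) (Pair x)"
    using x by (simp add: continuous_map_pairwise o_def)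
  have S: "openin Y S" "closedin Y S"
    unfolding S_def using openin_continuous_map_preimage[OF cont D(1)]
      closedin_continuous_map_preimage[OF cont D(2)] by auto
  let ?B = "topspace X \<times> S"
  have B: "openin (prod_topology X Y) ?B" "closedin (prod_topology X Y) ?B"
    using S by (auto simp: openin_prod_Times_iff closedin_prod_Times_iff)
  have "closedin (prod_topology X Y) ((D - ?B) \<union> (?B - D))"
    using D B by (intro closedin_Un closedin_diff)
  then have "closedin X (fst ` ((D - ?B) \<union> (?B - D)))"
    using closed_map_fst[OF Y, of X] unfolding closed_map_def by blast
  moreover have "?S = topspace X - fst ` ((D - ?B) \<union> (?B - D))"
    using openin_subset[OF D(1)] x unfolding S_def by (auto simp: image_iff Bex_def split_paired_Ex)
  ultimately show ?thesis by auto
qed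

context stone_median_algebra
begin

sublocale median_algebra "sma_carrier M" "sma_med M"
  by (rule median_algebra)

text \<open>
  Separate \<open>x\<close> and \<open>y\<close> by a clopen set \<open>C\<close>, which need not be convex, and pass to the
  coarsest congruence that saturates \<open>C\<close>, the syntactic congruence of \<open>C\<close>. In general
  such a congruence is tested by all unary polynomials, but the distributive law collapses
  nested maps \<open>z \<mapsto> m z a b\<close> into a single one, so the identity and these maps suffice. That
  makes the congruence a condition on \<open>C\<close> and on the slices of one clopen subset of \<open>M\<^sup>3\<close>,
  so its classes are open. Hence a half space of the quotient that separates the two classes
  has a clopen preimage.
\<close>

theorem clopen_half_space_separation:
  assumes x: "x \<in> sma_carrier M" and y: "y \<in> sma_carrier M" and "x \<noteq> y"
  obtains H where "H \<in> clopen_half_spaces M" "x \<in> H" "y \<notin> H"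
proof -
  let ?X = "sma_top M" and ?m = "sma_med M" and ?S = "sma_carrier M"
  let ?X2 = "prod_topology ?X ?X"
  obtain C where C: "openin ?X C" "closedin ?X C" "x \<in> C" "y \<notin> C"
    using Stone_space_clopen_separation[OF Stone_space assms] .
  \<comment> \<open>The value \<open>f z\<close> stands for the class of \<open>z\<close> under the syntactic congruence of \<open>C\<close>.\<close>
  define f where "f z = (z \<in> C, {(a, b). a \<in> ?S \<and> b \<in> ?S \<and> ?m z a b \<in> C})" for z
  have f_eq: "f z = f z' \<longleftrightarrow> (z \<in> C \<longleftrightarrow> z' \<in> C) \<and> (\<forall>a\<in>?S. \<forall>b\<in>?S. ?m z a b \<in> C \<longleftrightarrow> ?m z' a b \<in> C)" for z z'
    unfolding f_def by auto
  \<comment> \<open>By distributivity, testing \<open>m z a b\<close> with \<open>c\<close> and \<open>d\<close> amounts to testing \<open>z\<close> with \<open>m a c d\<close> and \<open>m b c d\<close>.\<close>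
  have cong1: "f (?m z a b) = f (?m z' a b)"
    if "f z = f z'" "z \<in> ?S" "z' \<in> ?S" "a \<in> ?S" "b \<in> ?S" for z z' a b
  proof -
    have "?m z u v \<in> C \<longleftrightarrow> ?m z' u v \<in> C" if "u \<in> ?S" "v \<in> ?S" for u v
      using \<open>f z = f z'\<close> that unfolding f_eq by blast
    then show ?thesis
      using that unfolding f_eq by (simp add: med_distrib med_closed)
  qed
  have cong: "f (?m a b c) = f (?m a' b' c')"
    if eq: "f a = f a'" "f b = f b'" "f c = f c'"
      and S: "a \<in> ?S" "a' \<in> ?S" "b \<in> ?S" "b' \<in> ?S" "c \<in> ?S" "c' \<in> ?S" for a b c a' b' c'
  proof -
    have "f (?m a b c) = f (?m a' b c)" using cong1[OF eq(1)] S by simp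
    also have "\<dots> = f (?m b a' c)" using S by (simp add: med_perm)
    also have "\<dots> = f (?m b' a' c)" using cong1[OF eq(2)] S by simp
    also have "\<dots> = f (?m c a' b')" using S by (simp add: med_perm)
    also have "\<dots> = f (?m c' a' b')" using cong1[OF eq(3)] S by simp
    also have "\<dots> = f (?m a' b' c')" using S by (simp add: med_perm)
    finally show ?thesis .
  qed
  define g where "g = inv_into ?S f"
  \<comment> \<open>The median on the quotient, computed on chosen representatives \<open>g u\<close>.\<close>
  define n where "n u v w = f (?m (g u) (g v) (g w))" for u v w
  have g: "g (f z) \<in> ?S" "f (g (f z)) = f z" if "z \<in> ?S" for z
    using that by (auto simp: g_def inv_into_into f_inv_into_f)
  have hom: "f (?m a b c) = n (f a) (f b) (f c)" if "a \<in> ?S" "b \<in> ?S" "c \<in> ?S" for a b c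
    unfolding n_def by (rule cong) (use that g in auto)
  have quotient: "median_algebra (f ` ?S) n"
    by (rule median_algebra_image[where f = f, OF median_algebra]) (simp_all add: hom)
  have "f x \<noteq> f y" using C by (simp add: f_def)
  then obtain K where K: "half_space (f ` ?S) n K" "f x \<in> K" "f y \<notin> K"
    using median_algebra.half_space_separation[OF quotient, of "f x" "f y"] x y by blast
  have "half_space ?S ?m {z \<in> ?S. f z \<in> K}"
    by (rule half_space_vimage[where f = f, OF K(1)]) (simp_all add: med_closed hom)
  define D where "D = {p \<in> topspace (prod_topology ?X ?X2). (\<lambda>(a, b, c). ?m a b c) p \<in> C}"
  have D: "openin (prod_topology ?X ?X2) D" "closedin (prod_topology ?X ?X2) D"
    unfolding D_def using openin_continuous_map_preimage[OF continuous_med C(1)]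
      closedin_continuous_map_preimage[OF continuous_med C(2)] by auto
  have compact: "compact_space ?X2"
    using Stone_space by (simp add: Stone_space_def compact_space_prod_topology)
  \<comment> \<open>The class of \<open>z\<close> consists of the points on the same side of \<open>C\<close> with the same slice of \<open>D\<close>.\<close>
  have fibre: "openin ?X {z' \<in> ?S. f z' = f z}" if z: "z \<in> ?S" for z
  proof -
    let ?T = "{z' \<in> ?S. \<forall>p\<in>topspace ?X2. (z', p) \<in> D \<longleftrightarrow> (z, p) \<in> D}"
    have "openin ?X (?T \<inter> (if z \<in> C then C else ?S - C))"
      using openin_same_slice[OF compact D z] C by (intro openin_Int) auto
    moreover have "?T \<inter> (if z \<in> C then C else ?S - C) = {z' \<in> ?S. f z' = f z}"
      using z openin_subset[OF C(1)] by (auto simp: f_eq D_def)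
    ultimately show ?thesis by simp
  qed
  have opn: "openin ?X {z \<in> ?S. f z \<in> L}" for L
  proof (subst openin_subopen, intro ballI)
    fix z assume "z \<in> {z \<in> ?S. f z \<in> L}"
    then show "\<exists>T. openin ?X T \<and> z \<in> T \<and> T \<subseteq> {z \<in> ?S. f z \<in> L}"
      using fibre[of z] by (intro exI[of _ "{z' \<in> ?S. f z' = f z}"]) auto
  qed
  have "openin ?X (?S - {z \<in> ?S. f z \<in> K})"
  proof -
    have "?S - {z \<in> ?S. f z \<in> K} = {z \<in> ?S. f z \<in> - K}" by auto
    then show ?thesis using opn[of "- K"] by simp
  qed
  then have "closedin ?X {z \<in> ?S. f z \<in> K}" by (auto simp: closedin_def)
  then have "{z \<in> ?S. f z \<in> K} \<in> clopen_half_spaces M"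
    using opn \<open>half_space ?S ?m {z \<in> ?S. f z \<in> K}\<close> by (simp add: clopen_half_spaces_def)
  then show thesis using that K x y by blast
qed

end

section \<open>Ultra filters\<close>

context poc_set
begin

lemma le_closed: "(a, b) \<in> poc_le P \<Longrightarrow> a \<in> poc_carrier P \<and> b \<in> poc_carrier P"
  using partial_order by (auto dest: partial_order_onD(4))

lemma le_refl: "a \<in> poc_carrier P \<Longrightarrow> (a, a) \<in> poc_le P"
  using partial_order_onD(1)[OF partial_order] by (simp add: refl_onD)

lemma le_trans: "(a, b) \<in> poc_le P \<Longrightarrow> (b, c) \<in> poc_le P \<Longrightarrow> (a, c) \<in> poc_le P"
  using partial_order_onD(2)[OF partial_order] by (rule transD)

lemma le_antisym: "(a, b) \<in> poc_le P \<Longrightarrow> (b, a) \<in> poc_le P \<Longrightarrow> a = b"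
  using partial_order_onD(3)[OF partial_order] by (rule antisymD)

lemma le_star_commute:
  "\<lbrakk>a \<in> poc_carrier P; b \<in> poc_carrier P\<rbrakk> \<Longrightarrow> (a, poc_star P b) \<in> poc_le P \<longleftrightarrow> (b, poc_star P a) \<in> poc_le P"
  by (metis star_antimono star_star)

lemma mem_ultra_filters_iff:
  "U \<in> ultra_filters P \<longleftrightarrow> U \<subseteq> poc_carrier P \<and> (\<forall>a b. a \<in> U \<and> (a, b) \<in> poc_le P \<longrightarrow> b \<in> U) \<and>
     (\<forall>a\<in>poc_carrier P. poc_star P a \<in> U \<longleftrightarrow> a \<notin> U)"
proof -
  have "U \<union> poc_star P ` U = poc_carrier P \<and> U \<inter> poc_star P ` U = {} \<longleftrightarrow>
      (\<forall>a\<in>poc_carrier P. poc_star P a \<in> U \<longleftrightarrow> a \<notin> U)" if "U \<subseteq> poc_carrier P"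
  proof -
    have img: "a \<in> poc_star P ` U \<longleftrightarrow> poc_star P a \<in> U" if "a \<in> poc_carrier P" for a
    proof
      show "poc_star P a \<in> U" if "a \<in> poc_star P ` U"
        using that \<open>U \<subseteq> poc_carrier P\<close> star_star by auto
      show "a \<in> poc_star P ` U" if "poc_star P a \<in> U"
        using imageI[OF that, of "poc_star P"] star_star[OF \<open>a \<in> poc_carrier P\<close>] by simp
    qed
    have "poc_star P ` U \<subseteq> poc_carrier P" using that star_closed by blast
    then have "U \<union> poc_star P ` U = poc_carrier P \<and> U \<inter> poc_star P ` U = {} \<longleftrightarrow>
        (\<forall>a\<in>poc_carrier P. a \<in> poc_star P ` U \<longleftrightarrow> a \<notin> U)"
      using that by blast
    then show ?thesis using img by simp
  qed
  then show ?thesis unfolding ultra_filters_def using le_closed by auto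
qed

lemma ultra_filter_subset: "U \<in> ultra_filters P \<Longrightarrow> U \<subseteq> poc_carrier P"
  by (simp add: mem_ultra_filters_iff)

lemma ultra_filter_upward: "\<lbrakk>U \<in> ultra_filters P; a \<in> U; (a, b) \<in> poc_le P\<rbrakk> \<Longrightarrow> b \<in> U"
  by (auto simp: mem_ultra_filters_iff)

lemma ultra_filter_star: "\<lbrakk>U \<in> ultra_filters P; a \<in> poc_carrier P\<rbrakk> \<Longrightarrow> poc_star P a \<in> U \<longleftrightarrow> a \<notin> U"
  by (simp add: mem_ultra_filters_iff)

lemma zero_notin_ultra_filter: "U \<in> ultra_filters P \<Longrightarrow> poc_zero P \<notin> U"
  using zero_least[OF star_closed[OF zero_closed]] zero_closed ultra_filter_star ultra_filter_upward by blast

lemma ultra_filter_eqI: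
  assumes "U \<in> ultra_filters P" "V \<in> ultra_filters P" "U \<subseteq> V"
  shows "U = V"
  using assms ultra_filter_star ultra_filter_subset by blast

text \<open>
  Two elements \<open>a\<close> and \<open>b\<close> of an ultra filter never satisfy \<open>a \<le> b\<^sup>*\<close>; with \<open>a = b\<close> this also
  excludes the zero. Consistency imposes exactly these restrictions, all of them on pairs,
  and this is what lies behind both compactness and the description of half spaces.
\<close>

definition consistent :: "'a set \<Rightarrow> bool" where
  "consistent A \<longleftrightarrow> A \<subseteq> poc_carrier P \<and> (\<forall>a\<in>A. \<forall>b\<in>A. (a, poc_star P b) \<notin> poc_le P)"

text \<open>
  By maximality every element \<open>c\<close> outside \<open>U\<close> satisfies \<open>c \<le> d\<^sup>*\<close> for \<open>d = c\<close> or some \<open>d\<close> in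
  \<open>U\<close>. Combining such a relation with \<open>a \<le> c\<close> for some \<open>a\<close> in \<open>U\<close>, or with the corresponding
  relation for \<open>c\<^sup>*\<close>, always produces a forbidden relation inside \<open>U\<close> or \<open>0 = 0\<^sup>*\<close>.
\<close>

lemma maximal_consistent_ultra_filter:
  assumes U: "consistent U" and max: "\<And>B. consistent B \<Longrightarrow> U \<subseteq> B \<Longrightarrow> B = U"
  shows "U \<in> ultra_filters P"
proof -
  have UP: "U \<subseteq> poc_carrier P" and con: "\<And>a b. a \<in> U \<Longrightarrow> b \<in> U \<Longrightarrow> (a, poc_star P b) \<notin> poc_le P"
    using U by (auto simp: consistent_def)
  have conflict: "\<exists>d\<in>insert c U. (c, poc_star P d) \<in> poc_le P" if c: "c \<in> poc_carrier P" "c \<notin> U" for c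
  proof -
    have "\<not> consistent (insert c U)" using max[of "insert c U"] c by blast
    then obtain a b where ab: "a \<in> insert c U" "b \<in> insert c U" "(a, poc_star P b) \<in> poc_le P"
      using UP c by (auto simp: consistent_def)
    then have "a = c \<or> b = c" using con by blast
    moreover have "(b, poc_star P a) \<in> poc_le P"
      using ab UP c by (subst le_star_commute) auto
    ultimately show ?thesis using ab by blast
  qed
  have up: "b \<in> U" if a: "a \<in> U" "(a, b) \<in> poc_le P" for a b
  proof (rule ccontr)
    assume "b \<notin> U"
    then obtain d where d: "d \<in> insert b U" "(b, poc_star P d) \<in> poc_le P"
      using conflict[of b] le_closed[OF a(2)] by blast
    then have "(a, poc_star P d) \<in> poc_le P" using a le_trans by blast
    moreover have "(a, poc_star P a) \<in> poc_le P" if "d = b"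
      using calculation a star_antimono[OF a(2)] le_trans that by blast
    ultimately show False using con a d by blast
  qed
  have "poc_star P c \<in> U \<longleftrightarrow> c \<notin> U" if c: "c \<in> poc_carrier P" for c
  proof
    show "c \<notin> U" if "poc_star P c \<in> U"
      using con[OF _ that, of c] le_refl[OF c] by (auto simp: star_star[OF c])
  next
    assume "c \<notin> U"
    show "poc_star P c \<in> U"
    proof (rule ccontr)
      assume "poc_star P c \<notin> U"
      then obtain d' where d': "d' \<in> insert (poc_star P c) U" "(poc_star P c, poc_star P d') \<in> poc_le P"
        using conflict[of "poc_star P c"] star_closed[OF c] by blast
      obtain d where d: "d \<in> insert c U" "(c, poc_star P d) \<in> poc_le P"
        using conflict[OF c \<open>c \<notin> U\<close>] by blast
      have dP: "d \<in> poc_carrier P" "d' \<in> poc_carrier P"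
        using d d' UP c star_closed by auto
      have d'c: "(d', c) \<in> poc_le P"
        using star_antimono[OF d'(2)] dP c by (simp add: star_star)
      have ds: "(d, poc_star P c) \<in> poc_le P" using d(2) dP c by (subst le_star_commute)
      show False
      proof (cases "d = c")
        case True
        show False
        proof (cases "d' = poc_star P c")
          case True
          then have "c = poc_star P c" using \<open>d = c\<close> d d'c by (intro le_antisym) auto
          moreover have "c = poc_zero P" using \<open>d = c\<close> d by (intro le_star_imp_zero) auto
          ultimately show False using zero_neq_star_zero by simp
        next
          case False
          then have "d' \<in> U" using d' by blast
          moreover have "(d', poc_star P d') \<in> poc_le P"
            using d'c ds d'(2) \<open>d = c\<close> le_trans by blast
          ultimately show False using con by blast
        qed
      next
        case False
        then have dU: "d \<in> U" using d by blast
        show False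
        proof (cases "d' = poc_star P c")
          case True
          then have "(d, poc_star P d) \<in> poc_le P" using ds d'c d(2) le_trans by blast
          then show False using con dU by blast
        next
          case False
          then have "d' \<in> U" "(d', poc_star P d) \<in> poc_le P" using d' d'c d(2) le_trans by blast+
          then show False using con dU by blast
        qed
      qed
    qed
  qed
  then show ?thesis using UP up by (auto simp: mem_ultra_filters_iff)
qed

lemma consistent_extends_to_ultra_filter:
  assumes "consistent A"
  obtains U where "U \<in> ultra_filters P" "A \<subseteq> U"
proof -
  let ?\<A> = "{B. consistent B \<and> A \<subseteq> B}"
  have "\<exists>U\<in>?\<A>. \<forall>B\<in>?\<A>. U \<subseteq> B \<longrightarrow> B = U"
  proof (rule subset_Zorn_nonempty)
    show "?\<A> \<noteq> {}" using assms by blast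
  next
    fix \<C> assume ne: "\<C> \<noteq> {}" and ch: "subset.chain ?\<A> \<C>"
    then have sub: "\<C> \<subseteq> ?\<A>" and lin: "\<And>A B. A \<in> \<C> \<Longrightarrow> B \<in> \<C> \<Longrightarrow> A \<subseteq> B \<or> B \<subseteq> A"
      by (auto simp: subset_chain_def)
    have "(a, poc_star P b) \<notin> poc_le P" if ab: "a \<in> \<Union>\<C>" "b \<in> \<Union>\<C>" for a b
    proof -
      obtain B D where "B \<in> \<C>" "a \<in> B" "D \<in> \<C>" "b \<in> D" using ab by auto
      then obtain E where "E \<in> \<C>" "a \<in> E" "b \<in> E" using lin by blast
      then show ?thesis using sub by (auto simp: consistent_def)
    qed
    moreover have "\<Union>\<C> \<subseteq> poc_carrier P" using sub by (auto simp: consistent_def)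
    moreover have "A \<subseteq> \<Union>\<C>" using sub ne by blast
    ultimately show "\<Union>\<C> \<in> ?\<A>" by (auto simp: consistent_def)
  qed
  then obtain U where U: "U \<in> ?\<A>" and max: "\<forall>B\<in>?\<A>. U \<subseteq> B \<longrightarrow> B = U"
    by (rule bexE)
  have "U \<in> ultra_filters P"
  proof (rule maximal_consistent_ultra_filter)
    show "consistent U" using U by simp
    show "B = U" if "consistent B" "U \<subseteq> B" for B
      using bspec[OF max, of B] that U by auto
  qed
  then show thesis using that U by blast
qed

end

section \<open>The dual of a poc set\<close>

text \<open>
  The generated topology is brought into the form in which Alexander's subbase theorem is
  stated.
\<close>

lemma topology_generated_by_eq_subbase:
  "topology (arbitrary union_of (finite intersection_of (\<lambda>x. x \<in> \<B>) relative_to \<Union>\<B>)) =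
     topology_generated_by \<B>" (is "?T = _")
  unfolding topology_eq
proof (intro allI iffI)
  fix S assume "openin ?T S"
  then show "openin (topology_generated_by \<B>) S"
    by (rule minimal_topology_subbase[rotated 2])
      (auto simp: topology_generated_by_Basis simp flip: topology_generated_by_topspace)
next
  fix S assume "openin (topology_generated_by \<B>) S"
  then have "generate_topology_on \<B> S" by (rule openin_topology_generated_by)
  then show "openin ?T S"
  proof induction
    case (Basis s)
    then have "(finite intersection_of (\<lambda>x. x \<in> \<B>) relative_to \<Union>\<B>) s"
      by (intro relative_to_subset_inc finite_intersection_of_inc) auto
    then show ?case unfolding openin_subbase by (rule arbitrary_union_of_inc)
  qed auto
qed

context poc_set
begin

text \<open>
  The set \<open>V(a)\<close> of the subbasis, which is also the value of the evaluation map at \<open>a\<close>.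
\<close>

definition basic_open :: "'a \<Rightarrow> 'a set set" where
  "basic_open a = {U \<in> ultra_filters P. a \<in> U}"

lemma carrier_dual [simp]: "sma_carrier (poc_dual P) = ultra_filters P"
  using sma_carrier_poc_dual poc_set_axioms by blast

lemma top_dual: "sma_top (poc_dual P) = topology_generated_by (basic_open ` poc_carrier P)"
  by (simp add: poc_dual_def basic_open_def Setcompr_eq_image image_def)

lemma med_dual [simp]: "sma_med (poc_dual P) U1 U2 U3 = (U1 \<inter> U2) \<union> (U2 \<inter> U3) \<union> (U3 \<inter> U1)"
  by (simp add: poc_dual_def)

lemma basic_open_star: "a \<in> poc_carrier P \<Longrightarrow> basic_open (poc_star P a) = ultra_filters P - basic_open a"
  by (auto simp: basic_open_def ultra_filter_star)

lemma basic_open_zero: "basic_open (poc_zero P) = {}"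
  by (auto simp: basic_open_def zero_notin_ultra_filter)

lemma openin_basic_open: "a \<in> poc_carrier P \<Longrightarrow> openin (sma_top (poc_dual P)) (basic_open a)"
  unfolding top_dual by (intro topology_generated_by_Basis) blast

lemma closedin_basic_open: "a \<in> poc_carrier P \<Longrightarrow> closedin (sma_top (poc_dual P)) (basic_open a)"
  using openin_basic_open[OF star_closed] by (auto simp: closedin_def basic_open_star) (auto simp: basic_open_def)

text \<open>
  If \<open>a \<le> b\<close> fails, then \<open>a\<close> and \<open>b\<^sup>*\<close> are consistent, so some ultra filter contains \<open>a\<close> but not
  \<open>b\<close>.
\<close>

lemma basic_open_subset_iff:
  assumes a: "a \<in> poc_carrier P" and b: "b \<in> poc_carrier P"
  shows "basic_open a \<subseteq> basic_open b \<longleftrightarrow> (a, b) \<in> poc_le P"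
proof
  assume sub: "basic_open a \<subseteq> basic_open b"
  show "(a, b) \<in> poc_le P"
  proof (rule ccontr)
    assume nle: "(a, b) \<notin> poc_le P"
    have "(a, poc_star P a) \<notin> poc_le P"
      using nle zero_least[OF b] le_star_imp_zero by metis
    moreover have "(poc_star P b, b) \<notin> poc_le P"
    proof
      assume "(poc_star P b, b) \<in> poc_le P"
      then have "poc_star P b = poc_zero P"
        using le_star_imp_zero[of "poc_star P b"] b by (simp add: star_star)
      then have "(a, b) \<in> poc_le P"
        using star_antimono[OF zero_least[OF star_closed[OF a]]] a b by (metis star_star)
      then show False using nle by blast
    qed
    moreover have "(poc_star P b, poc_star P a) \<notin> poc_le P"
      using nle star_antimono a b by (metis star_star)
    ultimately have "consistent {a, poc_star P b}"
      using nle a b by (auto simp: consistent_def star_star star_closed)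
    then obtain U where "U \<in> ultra_filters P" "{a, poc_star P b} \<subseteq> U"
      by (rule consistent_extends_to_ultra_filter)
    then show False using sub b by (auto simp: basic_open_def ultra_filter_star)
  qed
qed (auto simp: basic_open_def dest: ultra_filter_upward)

lemma median_ultra_filter:
  assumes "U1 \<in> ultra_filters P" "U2 \<in> ultra_filters P" "U3 \<in> ultra_filters P"
  shows "(U1 \<inter> U2) \<union> (U2 \<inter> U3) \<union> (U3 \<inter> U1) \<in> ultra_filters P"
  using assms unfolding mem_ultra_filters_iff by blast

lemma median_algebra_dual: "median_algebra (sma_carrier (poc_dual P)) (sma_med (poc_dual P))"
proof
  have "consistent {}" by (simp add: consistent_def)
  then show "sma_carrier (poc_dual P) \<noteq> {}"
    by (rule consistent_extends_to_ultra_filter) auto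
qed (auto simp: median_ultra_filter)

text \<open>
  If subbasic sets \<open>V(a)\<close>, \<open>a \<in> A\<close>, cover the dual, then no ultra filter contains all
  \<open>a\<^sup>*\<close>, so these elements are inconsistent: \<open>a\<^sup>* \<le> b\<close> for some \<open>a\<close> and \<open>b\<close> in \<open>A\<close>. Then \<open>V(a)\<close>
  and \<open>V(b)\<close> already form a subcover.
\<close>

lemma compact_dual: "compact_space (sma_top (poc_dual P))"
proof (rule Alexander_subbase)
  show "topology (arbitrary union_of (finite intersection_of (\<lambda>x. x \<in> basic_open ` poc_carrier P)
      relative_to \<Union>(basic_open ` poc_carrier P))) = sma_top (poc_dual P)"
    unfolding top_dual by (rule topology_generated_by_eq_subbase)
next
  fix C assume C: "C \<subseteq> basic_open ` poc_carrier P" "\<Union>C = topspace (sma_top (poc_dual P))"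
  define A where "A = {a \<in> poc_carrier P. basic_open a \<in> C}"
  have "\<not> consistent (poc_star P ` A)"
  proof
    assume "consistent (poc_star P ` A)"
    then obtain U where U: "U \<in> ultra_filters P" "poc_star P ` A \<subseteq> U"
      by (rule consistent_extends_to_ultra_filter)
    then have "U \<in> \<Union>C" using C(2) by simp
    then obtain W where "W \<in> C" "U \<in> W" by (rule UnionE)
    then obtain a where "a \<in> A" "U \<in> basic_open a" using C by (auto simp: A_def)
    then show False using U ultra_filter_star[OF U(1), of a] by (auto simp: basic_open_def A_def)
  qed
  then obtain a b where ab: "a \<in> A" "b \<in> A" "(poc_star P a, poc_star P (poc_star P b)) \<in> poc_le P"
    unfolding consistent_def by (auto simp: A_def star_closed)
  then have P: "a \<in> poc_carrier P" "b \<in> poc_carrier P" by (auto simp: A_def)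
  then have "basic_open (poc_star P a) \<subseteq> basic_open b"
    using ab by (subst basic_open_subset_iff) (auto simp: star_star star_closed)
  then have "basic_open a \<union> basic_open b = ultra_filters P" using P by (auto simp: basic_open_star) (auto simp: basic_open_def)
  then show "\<exists>C'. finite C' \<and> C' \<subseteq> C \<and> \<Union>C' = topspace (sma_top (poc_dual P))"
    using ab by (intro exI[of _ "{basic_open a, basic_open b}"]) (auto simp: A_def)
qed

lemma separating_element:
  assumes "U \<in> ultra_filters P" "W \<in> ultra_filters P" "U \<noteq> W"
  obtains a where "a \<in> poc_carrier P" "U \<in> basic_open a" "W \<notin> basic_open a"
  using assms ultra_filter_eqI[OF assms(1,2)] ultra_filter_subset[OF assms(1)] by (auto simp: basic_open_def)

lemma Stone_space_dual: "Stone_space (sma_top (poc_dual P))"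
  unfolding Stone_space_def
proof (intro conjI compact_dual)
  show "Hausdorff_space (sma_top (poc_dual P))"
    unfolding Hausdorff_space_def
  proof (intro allI impI)
    fix U W assume "U \<in> sma_carrier (poc_dual P) \<and> W \<in> sma_carrier (poc_dual P) \<and> U \<noteq> W"
    then have UW: "U \<in> ultra_filters P" "W \<in> ultra_filters P" "U \<noteq> W" by auto
    then obtain a where "a \<in> poc_carrier P" "U \<in> basic_open a" "W \<notin> basic_open a" by (rule separating_element)
    then show "\<exists>A B. openin (sma_top (poc_dual P)) A \<and> openin (sma_top (poc_dual P)) B \<and> U \<in> A \<and> W \<in> B \<and> disjnt A B"
      using UW openin_basic_open[of a] openin_basic_open[of "poc_star P a"]
      by (intro exI[of _ "basic_open a"] exI[of _ "basic_open (poc_star P a)"]) (auto simp: basic_open_star star_closed disjnt_def)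
  qed
  show "totally_disconnected_space (sma_top (poc_dual P))"
    unfolding totally_disconnected_space_def
  proof (intro allI impI ballI, rule ccontr)
    fix C U W assume C: "connectedin (sma_top (poc_dual P)) C" and U: "U \<in> C" and W: "W \<in> C" and "U \<noteq> W"
    then have "U \<in> ultra_filters P" "W \<in> ultra_filters P"
      using connectedin_subset_topspace[OF C] by auto
    then obtain a where a: "a \<in> poc_carrier P" "U \<in> basic_open a" "W \<notin> basic_open a"
      using \<open>U \<noteq> W\<close> by (rule separating_element)
    then show False
      using connectedin_clopen_cases[OF C closedin_basic_open openin_basic_open, of a] U W by (auto simp: disjnt_iff)
  qed
qed

lemma stone_median_algebra_dual: "stone_median_algebra (poc_dual P)"
proof (rule stone_median_algebra.intro)
  show "median_algebra (sma_carrier (poc_dual P)) (sma_med (poc_dual P))" by (rule median_algebra_dual)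
  show "Stone_space (sma_top (poc_dual P))" by (rule Stone_space_dual)
  let ?X = "sma_top (poc_dual P)"
  let ?X3 = "prod_topology ?X (prod_topology ?X ?X)"
  let ?f = "\<lambda>(x, y, z). sma_med (poc_dual P) x y z"
  have "continuous_map ?X3 (topology_generated_by (basic_open ` poc_carrier P)) ?f"
  proof (rule continuous_on_generated_topo)
    fix B assume "B \<in> basic_open ` poc_carrier P"
    then obtain a where a: "a \<in> poc_carrier P" "B = basic_open a" by blast
    let ?T = "ultra_filters P"
    have T: "openin ?X ?T" using openin_topspace[of ?X] by simp
    have "?f -` B \<inter> topspace ?X3 = (basic_open a \<times> basic_open a \<times> ?T) \<union> (?T \<times> basic_open a \<times> basic_open a) \<union> (basic_open a \<times> ?T \<times> basic_open a)"
      using a by (auto simp: basic_open_def median_ultra_filter)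
    then show "openin ?X3 (?f -` B \<inter> topspace ?X3)"
      using openin_basic_open[OF a(1)] T by (auto simp: openin_prod_Times_iff intro!: openin_Un)
  next
    have "topspace (topology_generated_by (basic_open ` poc_carrier P)) = ultra_filters P"
      using carrier_dual top_dual by simp
    then show "?f ` topspace ?X3 \<subseteq> \<Union>(basic_open ` poc_carrier P)"
      by (auto simp: median_ultra_filter)
  qed
  then show "continuous_map ?X3 ?X ?f" by (simp add: top_dual)
qed

lemma basic_open_clopen_half_space:
  assumes "a \<in> poc_carrier P"
  shows "basic_open a \<in> clopen_half_spaces (poc_dual P)"
  using openin_basic_open[OF assms] closedin_basic_open[OF assms]
  by (auto simp: clopen_half_spaces_def half_space_def median_convex_def basic_open_def median_ultra_filter)

text \<open>
  By the hypothesis on \<open>U\<close>, \<open>C\<close> meets \<open>V(a)\<close> for each \<open>a\<close> in \<open>U\<close>, since otherwise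
  \<open>C \<subseteq> V(a\<^sup>*)\<close>. Medians with \<open>U\<close> turn members of \<open>C\<close> that contain \<open>A\<close> and \<open>a\<close> respectively
  into one that contains both, so every finite subset of \<open>U\<close> is contained in a member of
  \<open>C\<close>. By compactness all of \<open>U\<close> is contained in a member of \<open>C\<close>, which then equals \<open>U\<close>.
  So closed convex sets are intersections of subbasic sets.
\<close>

lemma mem_closed_convexI:
  assumes closed: "closedin (sma_top (poc_dual P)) C"
    and convex: "median_convex (ultra_filters P) (sma_med (poc_dual P)) C"
    and U: "U \<in> ultra_filters P" and above: "\<And>a. a \<in> poc_carrier P \<Longrightarrow> C \<subseteq> basic_open a \<Longrightarrow> a \<in> U"
  shows "U \<in> C"
proof -
  have UP: "U \<subseteq> poc_carrier P" using U by (rule ultra_filter_subset)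
  have CP: "C \<subseteq> ultra_filters P" using convex by (simp add: median_convex_def)
  have "C \<noteq> {}" using above[OF zero_closed] zero_notin_ultra_filter[OF U] by blast
  have meets: "\<exists>W\<in>C. a \<in> W" if a: "a \<in> U" for a
  proof (rule ccontr)
    assume "\<not> (\<exists>W\<in>C. a \<in> W)"
    moreover have "a \<in> poc_carrier P" using UP a by blast
    ultimately have "C \<subseteq> basic_open (poc_star P a)"
      using CP by (auto simp: basic_open_def ultra_filter_star)
    then have "poc_star P a \<in> U" using UP a above star_closed by blast
    then show False using ultra_filter_star[OF U] UP a by blast
  qed
  have fin: "\<exists>W\<in>C. A \<subseteq> W" if "finite A" "A \<subseteq> U" for A
    using that
  proof induction
    case empty
    then show ?case using \<open>C \<noteq> {}\<close> by blast
  next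
    case (insert a A)
    then obtain W W' where W: "W \<in> C" "A \<subseteq> W" "W' \<in> C" "a \<in> W'" using meets[of a] by auto
    then have "(W \<inter> W') \<union> (W' \<inter> U) \<union> (U \<inter> W) \<in> C"
      using convex U by (auto simp: median_convex_def)
    moreover have "insert a A \<subseteq> (W \<inter> W') \<union> (W' \<inter> U) \<union> (U \<inter> W)" using W insert.prems by auto
    ultimately show ?case by blast
  qed
  have "compactin (sma_top (poc_dual P)) C"
    using closed compact_dual by (rule closedin_compact_space[rotated])
  moreover have "\<forall>D\<in>basic_open ` U. closedin (sma_top (poc_dual P)) D" using closedin_basic_open UP by blast
  moreover have "C \<inter> \<Inter>\<F> \<noteq> {}" if \<F>: "finite \<F>" "\<F> \<subseteq> basic_open ` U" for \<F>
  proof -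
    obtain A where A: "A \<subseteq> U" "finite A" "\<F> = basic_open ` A"
      using finite_subset_image[OF \<F>] by blast
    then obtain W where "W \<in> C" "A \<subseteq> W" using fin by blast
    then show ?thesis using CP A by (auto simp: basic_open_def)
  qed
  ultimately have "C \<inter> \<Inter>(basic_open ` U) \<noteq> {}" unfolding compactin_fip by blast
  then obtain W where "W \<in> C" "\<And>a. a \<in> U \<Longrightarrow> W \<in> basic_open a" by blast
  then have "W \<in> C" "U \<subseteq> W" by (auto simp: basic_open_def)
  then show ?thesis using ultra_filter_eqI[OF U] CP by blast
qed

text \<open>
  Let \<open>A\<close> and \<open>B\<close> consist of the elements whose subbasic sets contain \<open>H\<close>, respectively its complement.
  An ultra filter containing \<open>A \<union> B\<close> would lie in \<open>H\<close> and in its complement, both being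
  closed and convex. So \<open>A \<union> B\<close> is inconsistent, that is, two of its elements, possibly equal, have disjoint
  subbasic sets. If these come from \<open>A\<close> and from \<open>B\<close>, then disjointness forces the first to
  be \<open>H\<close>; if both come from \<open>A\<close> or both from \<open>B\<close>, then \<open>H\<close> or its complement is empty.
\<close>

lemma clopen_half_space_eq_basic_open:
  assumes "H \<in> clopen_half_spaces (poc_dual P)"
  obtains a where "a \<in> poc_carrier P" "H = basic_open a"
proof -
  let ?T = "ultra_filters P"
  have cl: "closedin (sma_top (poc_dual P)) H" "closedin (sma_top (poc_dual P)) (?T - H)"
    and cv: "median_convex ?T (sma_med (poc_dual P)) H" "median_convex ?T (sma_med (poc_dual P)) (?T - H)"
    and HT: "H \<subseteq> ?T"
    using assms closedin_diff[OF closedin_topspace, of "sma_top (poc_dual P)" H]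
    by (auto simp: clopen_half_spaces_def half_space_def)
  define A where "A = {a \<in> poc_carrier P. H \<subseteq> basic_open a}"
  define B where "B = {a \<in> poc_carrier P. ?T - H \<subseteq> basic_open a}"
  have "\<not> consistent (A \<union> B)"
  proof
    assume "consistent (A \<union> B)"
    then obtain U where U: "U \<in> ?T" "A \<union> B \<subseteq> U" by (rule consistent_extends_to_ultra_filter)
    then have "U \<in> H" by (intro mem_closed_convexI[OF cl(1) cv(1)]) (auto simp: A_def)
    moreover have "U \<in> ?T - H"
      using U by (intro mem_closed_convexI[OF cl(2) cv(2)]) (auto simp: B_def)
    ultimately show False by blast
  qed
  then obtain a b where ab: "a \<in> A \<union> B" "b \<in> A \<union> B" "(a, poc_star P b) \<in> poc_le P"
    unfolding consistent_def by (auto simp: A_def B_def)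
  then have P: "a \<in> poc_carrier P" "b \<in> poc_carrier P" by (auto simp: A_def B_def)
  then have sub: "basic_open a \<subseteq> ?T - basic_open b" using ab by (simp add: basic_open_subset_iff star_closed flip: basic_open_star)
  have V0: "basic_open (poc_star P (poc_zero P)) = ?T" using zero_closed by (simp add: basic_open_star basic_open_zero)
  consider "a \<in> A" "b \<in> A" | "a \<in> B" "b \<in> B" | "a \<in> A" "b \<in> B" | "a \<in> B" "b \<in> A" using ab by blast
  then show thesis
  proof cases
    case 1
    then have "H = {}" using sub by (auto simp: A_def)
    then show thesis using that[OF zero_closed] basic_open_zero by simp
  next
    case 2
    then have "H = ?T" using sub HT by (auto simp: B_def)
    then show thesis using that[OF star_closed[OF zero_closed]] V0 by simp
  next
    case 3
    then have "H = basic_open a" using sub HT by (auto simp: A_def B_def basic_open_def)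
    then show thesis using that P by blast
  next
    case 4
    then have "H = basic_open b" using sub HT by (auto simp: A_def B_def basic_open_def)
    then show thesis using that P by blast
  qed
qed

end

section \<open>Functoriality of the two duals\<close>

lemma poc_homD:
  assumes "f \<in> poc_hom P Q"
  shows "a \<in> poc_carrier P \<Longrightarrow> f a \<in> poc_carrier Q"
    and "(a, b) \<in> poc_le P \<Longrightarrow> (f a, f b) \<in> poc_le Q"
    and "a \<in> poc_carrier P \<Longrightarrow> f (poc_star P a) = poc_star Q (f a)"
  using assms by (auto simp: poc_hom_def)

lemma sma_homD:
  assumes "f \<in> sma_hom M N"
  shows "x \<in> sma_carrier M \<Longrightarrow> f x \<in> sma_carrier N"
    and "continuous_map (sma_top M) (sma_top N) f"
    and "\<lbrakk>x \<in> sma_carrier M; y \<in> sma_carrier M; z \<in> sma_carrier M\<rbrakk> \<Longrightarrow>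
           f (sma_med M x y z) = sma_med N (f x) (f y) (f z)"
  using assms by (auto simp: sma_hom_def)

lemma ultra_filter_vimage:
  assumes "poc_set P" "poc_set Q" and f: "f \<in> poc_hom P Q" and W: "W \<in> ultra_filters Q"
  shows "{a \<in> poc_carrier P. f a \<in> W} \<in> ultra_filters P"
proof -
  interpret P: poc_set P by fact
  interpret Q: poc_set Q by fact
  show ?thesis
    unfolding P.mem_ultra_filters_iff
  proof (intro conjI allI impI ballI)
    fix a b assume "a \<in> {a \<in> poc_carrier P. f a \<in> W} \<and> (a, b) \<in> poc_le P"
    then show "b \<in> {a \<in> poc_carrier P. f a \<in> W}"
      using Q.ultra_filter_upward[OF W] poc_homD(2)[OF f] P.le_closed by blast
  next
    fix a assume "a \<in> poc_carrier P"
    then show "poc_star P a \<in> {a \<in> poc_carrier P. f a \<in> W} \<longleftrightarrow> a \<notin> {a \<in> poc_carrier P. f a \<in> W}"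
      by (simp add: P.star_closed poc_homD[OF f] Q.ultra_filter_star[OF W])
  qed blast
qed

lemma poc_dual_map_apply:
  "W \<in> ultra_filters Q \<Longrightarrow> poc_dual_map P Q f W = {a \<in> poc_carrier P. f a \<in> W}"
  by (simp add: poc_dual_map_def)

lemma poc_dual_map_hom:
  assumes P: "poc_set P" and Q: "poc_set Q" and f: "f \<in> poc_hom P Q"
  shows "poc_dual_map P Q f \<in> sma_hom (poc_dual Q) (poc_dual P)"
proof -
  interpret P: poc_set P by fact
  interpret Q: poc_set Q by fact
  let ?F = "poc_dual_map P Q f"
  have into: "?F W \<in> ultra_filters P" if "W \<in> ultra_filters Q" for W
    using ultra_filter_vimage[OF P Q f that] that by (simp add: poc_dual_map_apply)
  have "continuous_map (sma_top (poc_dual Q)) (topology_generated_by (P.basic_open ` poc_carrier P)) ?F"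
  proof (rule continuous_on_generated_topo)
    fix B assume "B \<in> P.basic_open ` poc_carrier P"
    then obtain a where a: "a \<in> poc_carrier P" "B = P.basic_open a" by blast
    have "?F W \<in> B \<longleftrightarrow> f a \<in> W" if "W \<in> ultra_filters Q" for W
      using a into[OF that] by (simp add: P.basic_open_def poc_dual_map_apply[OF that])
    then have "?F -` B \<inter> sma_carrier (poc_dual Q) = Q.basic_open (f a)"
      by (auto simp: Q.basic_open_def)
    then show "openin (sma_top (poc_dual Q)) (?F -` B \<inter> sma_carrier (poc_dual Q))"
      using Q.openin_basic_open poc_homD(1)[OF f a(1)] by simp
  next
    have "\<Union>(P.basic_open ` poc_carrier P) = ultra_filters P"
      using P.carrier_dual P.top_dual by simp
    then show "?F ` sma_carrier (poc_dual Q) \<subseteq> \<Union>(P.basic_open ` poc_carrier P)"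
      using into by auto
  qed
  then have "continuous_map (sma_top (poc_dual Q)) (sma_top (poc_dual P)) ?F"
    by (simp add: P.top_dual)
  moreover have "?F \<in> sma_carrier (poc_dual Q) \<rightarrow>\<^sub>E sma_carrier (poc_dual P)"
    using into by (auto simp: poc_dual_map_def)
  moreover have "?F (sma_med (poc_dual Q) U1 U2 U3) = sma_med (poc_dual P) (?F U1) (?F U2) (?F U3)"
    if "U1 \<in> ultra_filters Q" "U2 \<in> ultra_filters Q" "U3 \<in> ultra_filters Q" for U1 U2 U3
    using that by (auto simp: poc_dual_map_apply Q.median_ultra_filter)
  ultimately show ?thesis by (simp add: sma_hom_def)
qed

lemma poc_dual_map_id: "poc_set P \<Longrightarrow> poc_dual_map P P (poc_id P) = sma_id (poc_dual P)"
  using poc_set.ultra_filter_subset[of P]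
  by (auto simp: poc_dual_map_def sma_id_def poc_id_def poc_set.carrier_dual restrict_def fun_eq_iff)

lemma poc_dual_map_compose:
  assumes "poc_set P" "poc_set Q" "poc_set R" and f: "f \<in> poc_hom P Q" and g: "g \<in> poc_hom Q R"
  shows "poc_dual_map P R (compose (poc_carrier P) g f) =
    compose (sma_carrier (poc_dual R)) (poc_dual_map P Q f) (poc_dual_map Q R g)"
proof
  fix W
  show "poc_dual_map P R (compose (poc_carrier P) g f) W =
    compose (sma_carrier (poc_dual R)) (poc_dual_map P Q f) (poc_dual_map Q R g) W"
  proof (cases "W \<in> ultra_filters R")
    case True
    then have "{b \<in> poc_carrier Q. g b \<in> W} \<in> ultra_filters Q"
      using ultra_filter_vimage assms by blast
    then show ?thesis
      using True assms(3) poc_homD(1)[OF f]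
      by (auto simp: compose_def poc_set.carrier_dual poc_dual_map_apply)
  next
    case False
    then show ?thesis using assms(3) by (simp add: compose_def poc_set.carrier_dual poc_dual_map_def)
  qed
qed

lemma sma_dual_simps [simp]:
  "poc_carrier (sma_dual M) = clopen_half_spaces M"
  "(H, K) \<in> poc_le (sma_dual M) \<longleftrightarrow> H \<in> clopen_half_spaces M \<and> K \<in> clopen_half_spaces M \<and> H \<subseteq> K"
  "poc_zero (sma_dual M) = {}"
  "poc_star (sma_dual M) H = sma_carrier M - H"
  by (simp_all add: sma_dual_def)

lemma clopen_half_space_subset: "H \<in> clopen_half_spaces M \<Longrightarrow> H \<subseteq> sma_carrier M"
  by (simp add: clopen_half_spaces_def half_space_def)

lemma clopen_half_space_compl: "H \<in> clopen_half_spaces M \<Longrightarrow> sma_carrier M - H \<in> clopen_half_spaces M"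
  by (auto simp: clopen_half_spaces_def half_space_def double_diff)

context stone_median_algebra
begin

lemma poc_set_dual: "poc_set (sma_dual M)"
proof
  show "partial_order_on (poc_carrier (sma_dual M)) (poc_le (sma_dual M))"
    by (auto simp: partial_order_on_def preorder_on_def refl_on_def trans_def antisym_def)
  show "poc_zero (sma_dual M) \<in> poc_carrier (sma_dual M)"
    by (auto simp: clopen_half_spaces_def half_space_def median_convex_def med_closed)
  then show "(poc_zero (sma_dual M), H) \<in> poc_le (sma_dual M)" if "H \<in> poc_carrier (sma_dual M)" for H
    using that by simp
  show "poc_zero (sma_dual M) \<noteq> poc_star (sma_dual M) (poc_zero (sma_dual M))"
    unfolding sma_dual_simps using nonempty by blast
qed (use clopen_half_space_subset in \<open>auto simp: clopen_half_space_compl\<close>)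

end

lemma clopen_half_space_vimage:
  assumes "stone_median_algebra M" and f: "f \<in> sma_hom M N" and H: "H \<in> clopen_half_spaces N"
  shows "{x \<in> sma_carrier M. f x \<in> H} \<in> clopen_half_spaces M"
proof -
  interpret stone_median_algebra M by fact
  have "half_space (sma_carrier M) (sma_med M) {x \<in> sma_carrier M. f x \<in> H}"
    using H sma_homD[OF f]
    by (intro half_space_vimage[where f = f and n = "sma_med N" and N = "sma_carrier N"])
      (auto simp: clopen_half_spaces_def med_closed)
  then show ?thesis
    using H openin_continuous_map_preimage[OF sma_homD(2)[OF f]]
      closedin_continuous_map_preimage[OF sma_homD(2)[OF f]]
    by (simp add: clopen_half_spaces_def)
qed

lemma sma_dual_map_apply:
  "H \<in> clopen_half_spaces N \<Longrightarrow> sma_dual_map M N f H = {x \<in> sma_carrier M. f x \<in> H}"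
  by (simp add: sma_dual_map_def)

lemma sma_dual_map_hom:
  assumes "stone_median_algebra M" "stone_median_algebra N" and f: "f \<in> sma_hom M N"
  shows "sma_dual_map M N f \<in> poc_hom (sma_dual N) (sma_dual M)"
proof -
  have "sma_dual_map M N f H \<in> clopen_half_spaces M" if "H \<in> clopen_half_spaces N" for H
    using clopen_half_space_vimage[OF assms(1) f that] that by (simp add: sma_dual_map_apply)
  moreover have "{} \<in> clopen_half_spaces N"
    using poc_set.zero_closed[OF stone_median_algebra.poc_set_dual[OF assms(2)]] by simp
  ultimately show ?thesis
    using sma_homD(1)[OF f] clopen_half_space_compl[of _ N]
    by (auto simp: poc_hom_def sma_dual_map_apply) (auto simp: sma_dual_map_def)
qed

lemma sma_dual_map_id: "sma_dual_map M M (sma_id M) = poc_id (sma_dual M)"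
  using clopen_half_space_subset[of _ M]
  by (auto simp: sma_dual_map_def sma_id_def poc_id_def restrict_def fun_eq_iff)

lemma sma_dual_map_compose:
  assumes "stone_median_algebra N" and f: "f \<in> sma_hom M N" and g: "g \<in> sma_hom N K"
  shows "sma_dual_map M K (compose (sma_carrier M) g f) =
    compose (poc_carrier (sma_dual K)) (sma_dual_map M N f) (sma_dual_map N K g)"
proof
  fix H
  show "sma_dual_map M K (compose (sma_carrier M) g f) H =
    compose (poc_carrier (sma_dual K)) (sma_dual_map M N f) (sma_dual_map N K g) H"
  proof (cases "H \<in> clopen_half_spaces K")
    case True
    then have "{y \<in> sma_carrier N. g y \<in> H} \<in> clopen_half_spaces N"
      using clopen_half_space_vimage assms by blast
    then show ?thesis
      using True sma_homD(1)[OF f] by (auto simp: compose_def sma_dual_map_apply)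
  next
    case False
    then show ?thesis by (simp add: compose_def sma_dual_map_def)
  qed
qed

section \<open>The evaluation maps\<close>

text \<open>
  Reflecting the order is a separate requirement, since a bijective poc morphism need not
  have a monotone inverse.
\<close>

lemma poc_isoI:
  assumes "poc_set P" "poc_set Q" and f: "f \<in> poc_hom P Q"
    and onto: "f ` poc_carrier P = poc_carrier Q"
    and reflects: "\<And>a b. \<lbrakk>a \<in> poc_carrier P; b \<in> poc_carrier P; (f a, f b) \<in> poc_le Q\<rbrakk> \<Longrightarrow> (a, b) \<in> poc_le P"
  shows "f \<in> poc_iso P Q"
proof -
  interpret P: poc_set P by fact
  interpret Q: poc_set Q by fact
  have inj: "inj_on f (poc_carrier P)"
  proof (rule inj_onI)
    fix a b assume ab: "a \<in> poc_carrier P" "b \<in> poc_carrier P" "f a = f b"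
    then have "(f a, f b) \<in> poc_le Q" "(f b, f a) \<in> poc_le Q"
      using Q.le_refl poc_homD(1)[OF f] by auto
    then show "a = b" using ab reflects P.le_antisym by blast
  qed
  define g where "g = restrict (inv_into (poc_carrier P) f) (poc_carrier Q)"
  have gf: "g (f a) = a" if "a \<in> poc_carrier P" for a
    using that inj poc_homD(1)[OF f] by (simp add: g_def)
  have fg: "f (g b) = b" "g b \<in> poc_carrier P" if "b \<in> poc_carrier Q" for b
    using that onto by (auto simp: g_def f_inv_into_f inv_into_into)
  have "g \<in> poc_hom Q P"
    unfolding poc_hom_def
  proof (intro CollectI conjI allI impI ballI)
    show "g \<in> poc_carrier Q \<rightarrow>\<^sub>E poc_carrier P" using fg by (auto simp: g_def)
    show "(g a, g b) \<in> poc_le P" if "(a, b) \<in> poc_le Q" for a b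
      using that fg Q.le_closed[OF that] by (intro reflects) auto
    show "g (poc_zero Q) = poc_zero P"
      using gf[OF P.zero_closed] f by (simp add: poc_hom_def)
    show "g (poc_star Q b) = poc_star P (g b)" if "b \<in> poc_carrier Q" for b
      using gf[OF P.star_closed[OF fg(2)[OF that]]] poc_homD(3)[OF f fg(2)[OF that]] fg(1)[OF that] by simp
  qed
  moreover have "compose (poc_carrier P) g f = poc_id P" "compose (poc_carrier Q) f g = poc_id Q"
    by (auto simp: compose_def poc_id_def gf fg restrict_def)
  ultimately show ?thesis using f by (auto simp: poc_iso_def)
qed

text \<open>
  A continuous bijection from a compact space onto a Hausdorff space is a homeomorphism, so
  the inverse is continuous.
\<close>

lemma sma_isoI:
  assumes "stone_median_algebra M" "stone_median_algebra N" and f: "f \<in> sma_hom M N"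
    and onto: "f ` sma_carrier M = sma_carrier N" and inj: "inj_on f (sma_carrier M)"
  shows "f \<in> sma_iso M N"
proof -
  interpret M: stone_median_algebra M by fact
  interpret N: stone_median_algebra N by fact
  have "homeomorphic_map (sma_top M) (sma_top N) f"
    using M.Stone_space N.Stone_space sma_homD(2)[OF f] onto inj
    by (intro continuous_imp_homeomorphic_map) (auto simp: Stone_space_def)
  then obtain h where h: "homeomorphic_maps (sma_top M) (sma_top N) f h"
    by (auto simp: homeomorphic_map_maps)
  define g where "g = restrict h (sma_carrier N)"
  have gf: "g (f x) = x" if "x \<in> sma_carrier M" for x
    using that h sma_homD(1)[OF f] by (simp add: g_def homeomorphic_maps_def)
  have cont: "continuous_map (sma_top N) (sma_top M) g"
    using h by (auto simp: g_def homeomorphic_maps_def intro: continuous_map_eq)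
  have fg: "f (g y) = y" "g y \<in> sma_carrier M" if "y \<in> sma_carrier N" for y
    using that h funcset_mem[OF continuous_map_funspace[OF cont] that]
    by (auto simp: g_def homeomorphic_maps_def)
  have "g \<in> sma_hom N M"
    unfolding sma_hom_def
  proof (intro CollectI conjI ballI cont)
    show "g \<in> sma_carrier N \<rightarrow>\<^sub>E sma_carrier M" using fg by (auto simp: g_def)
    fix x y z assume xyz: "x \<in> sma_carrier N" "y \<in> sma_carrier N" "z \<in> sma_carrier N"
    have "f (sma_med M (g x) (g y) (g z)) = sma_med N x y z"
      using sma_homD(3)[OF f] fg xyz by simp
    then show "g (sma_med N x y z) = sma_med M (g x) (g y) (g z)"
      using gf[OF M.med_closed[OF fg(2)[OF xyz(1)] fg(2)[OF xyz(2)] fg(2)[OF xyz(3)]]] by simp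
  qed
  moreover have "compose (sma_carrier M) g f = sma_id M" "compose (sma_carrier N) f g = sma_id N"
    by (auto simp: compose_def sma_id_def gf fg restrict_def)
  ultimately show ?thesis using f by (auto simp: sma_iso_def)
qed

lemma (in poc_set) poc_ev_apply: "a \<in> poc_carrier P \<Longrightarrow> poc_ev P a = basic_open a"
  by (simp add: poc_ev_def basic_open_def)

lemma (in poc_set) poc_ev_iso: "poc_ev P \<in> poc_iso P (sma_dual (poc_dual P))"
proof (rule poc_isoI)
  show "poc_set P" by (rule poc_set_axioms)
  show "poc_set (sma_dual (poc_dual P))"
    by (rule stone_median_algebra.poc_set_dual[OF stone_median_algebra_dual])
  show "poc_ev P \<in> poc_hom P (sma_dual (poc_dual P))"
    unfolding poc_hom_def
  proof (intro CollectI conjI allI impI ballI)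
    show "poc_ev P \<in> poc_carrier P \<rightarrow>\<^sub>E poc_carrier (sma_dual (poc_dual P))"
      using basic_open_clopen_half_space by (auto simp: poc_ev_apply) (auto simp: poc_ev_def)
    show "(poc_ev P a, poc_ev P b) \<in> poc_le (sma_dual (poc_dual P))" if "(a, b) \<in> poc_le P" for a b
      using le_closed[OF that] that basic_open_clopen_half_space
      by (simp add: poc_ev_apply basic_open_subset_iff)
    show "poc_ev P (poc_zero P) = poc_zero (sma_dual (poc_dual P))"
      by (simp add: poc_ev_apply zero_closed basic_open_zero)
    show "poc_ev P (poc_star P a) = poc_star (sma_dual (poc_dual P)) (poc_ev P a)" if "a \<in> poc_carrier P" for a
      using that by (simp add: poc_ev_apply star_closed basic_open_star)
  qed
  show "poc_ev P ` poc_carrier P = poc_carrier (sma_dual (poc_dual P))"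
  proof (rule set_eqI, rule iffI)
    fix H assume "H \<in> poc_carrier (sma_dual (poc_dual P))"
    then have "H \<in> clopen_half_spaces (poc_dual P)" by simp
    then obtain a where "a \<in> poc_carrier P" "H = basic_open a" by (rule clopen_half_space_eq_basic_open)
    then show "H \<in> poc_ev P ` poc_carrier P" by (auto simp: poc_ev_apply)
  qed (use basic_open_clopen_half_space in \<open>auto simp: poc_ev_apply\<close>)
  show "(a, b) \<in> poc_le P"
    if "a \<in> poc_carrier P" "b \<in> poc_carrier P" "(poc_ev P a, poc_ev P b) \<in> poc_le (sma_dual (poc_dual P))" for a b
    using that by (simp add: poc_ev_apply basic_open_subset_iff)
qed

lemma poc_ev_natural:
  assumes P: "poc_set P" and Q: "poc_set Q" and f: "f \<in> poc_hom P Q"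
  shows "compose (poc_carrier P) (poc_ev Q) f =
    compose (poc_carrier P) (sma_dual_map (poc_dual Q) (poc_dual P) (poc_dual_map P Q f)) (poc_ev P)"
proof
  fix a
  interpret P: poc_set P by fact
  interpret Q: poc_set Q by fact
  show "compose (poc_carrier P) (poc_ev Q) f a =
    compose (poc_carrier P) (sma_dual_map (poc_dual Q) (poc_dual P) (poc_dual_map P Q f)) (poc_ev P) a"
  proof (cases "a \<in> poc_carrier P")
    case True
    then show ?thesis
      using ultra_filter_vimage[OF P Q f] poc_homD(1)[OF f True] P.basic_open_clopen_half_space[OF True]
      by (auto simp: compose_def P.poc_ev_apply Q.poc_ev_apply sma_dual_map_apply poc_dual_map_apply
          P.basic_open_def Q.basic_open_def)
  qed (simp add: compose_def)
qed

text \<open>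
  The characteristic function of a half space is a median morphism to the two-element median
  algebra, where the median is the majority.
\<close>

lemma (in median_algebra) med_mem_half_space_iff:
  assumes H: "half_space M m H" and M: "x \<in> M" "y \<in> M" "z \<in> M"
  shows "m x y z \<in> H \<longleftrightarrow> x \<in> H \<and> y \<in> H \<or> y \<in> H \<and> z \<in> H \<or> z \<in> H \<and> x \<in> H"
proof -
  have two: "m x y z \<in> C" if "median_convex M m C" "x \<in> C \<and> y \<in> C \<or> y \<in> C \<and> z \<in> C \<or> z \<in> C \<and> x \<in> C" for C
  proof -
    have "m y z x = m x y z" "m z x y = m x y z" using M by (simp_all add: med_perm)
    then show ?thesis using that M unfolding median_convex_def by metis
  qed
  have "median_convex M m H" "median_convex M m (M - H)" using H by (auto simp: half_space_def)
  then show ?thesis using two[of H] two[of "M - H"] M by blast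
qed

context stone_median_algebra
begin

lemma sma_ev_apply: "x \<in> sma_carrier M \<Longrightarrow> sma_ev M x = {H \<in> clopen_half_spaces M. x \<in> H}"
  by (simp add: sma_ev_def)

lemma sma_ev_ultra_filter:
  assumes "x \<in> sma_carrier M"
  shows "sma_ev M x \<in> ultra_filters (sma_dual M)"
proof -
  interpret D: poc_set "sma_dual M" by (rule poc_set_dual)
  show ?thesis
    unfolding D.mem_ultra_filters_iff using assms by (auto simp: sma_ev_apply clopen_half_space_compl)
qed

lemma sma_ev_hom: "sma_ev M \<in> sma_hom M (poc_dual (sma_dual M))"
proof -
  interpret D: poc_set "sma_dual M" by (rule poc_set_dual)
  have "continuous_map (sma_top M) (topology_generated_by (D.basic_open ` clopen_half_spaces M)) (sma_ev M)"
  proof (rule continuous_on_generated_topo)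
    fix B assume "B \<in> D.basic_open ` clopen_half_spaces M"
    then obtain H where H: "H \<in> clopen_half_spaces M" "B = D.basic_open H" by blast
    then have "sma_ev M -` B \<inter> sma_carrier M = H"
      using clopen_half_space_subset[OF H(1)] sma_ev_ultra_filter
      by (auto simp: D.basic_open_def sma_ev_apply)
    then show "openin (sma_top M) (sma_ev M -` B \<inter> sma_carrier M)"
      using H by (simp add: clopen_half_spaces_def)
  next
    have "\<Union>(D.basic_open ` clopen_half_spaces M) = ultra_filters (sma_dual M)"
      using D.carrier_dual D.top_dual by simp
    then show "sma_ev M ` sma_carrier M \<subseteq> \<Union>(D.basic_open ` clopen_half_spaces M)"
      using sma_ev_ultra_filter by blast
  qed
  then have "continuous_map (sma_top M) (sma_top (poc_dual (sma_dual M))) (sma_ev M)"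
    by (simp add: D.top_dual)
  moreover have "sma_ev M \<in> sma_carrier M \<rightarrow>\<^sub>E sma_carrier (poc_dual (sma_dual M))"
    using sma_ev_ultra_filter by (auto simp: sma_ev_def)
  moreover have "sma_ev M (sma_med M x y z) =
      sma_med (poc_dual (sma_dual M)) (sma_ev M x) (sma_ev M y) (sma_ev M z)"
    if xyz: "x \<in> sma_carrier M" "y \<in> sma_carrier M" "z \<in> sma_carrier M" for x y z
  proof -
    have "sma_med M x y z \<in> H \<longleftrightarrow> x \<in> H \<and> y \<in> H \<or> y \<in> H \<and> z \<in> H \<or> z \<in> H \<and> x \<in> H"
      if "H \<in> clopen_half_spaces M" for H
      using that xyz by (intro med_mem_half_space_iff) (auto simp: clopen_half_spaces_def)
    then show ?thesis using xyz by (auto simp: sma_ev_apply med_closed)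
  qed
  ultimately show ?thesis by (simp add: sma_hom_def)
qed

text \<open>
  The members of \<open>U\<close> are closed, convex and pairwise intersecting, so by Helly's theorem and
  compactness they have a common point \<open>x\<close>. Then \<open>U\<close> is contained in the evaluation at \<open>x\<close>,
  and ultra filters are incomparable.
\<close>

lemma sma_ev_onto:
  assumes U: "U \<in> ultra_filters (sma_dual M)"
  obtains x where "x \<in> sma_carrier M" "sma_ev M x = U"
proof -
  interpret D: poc_set "sma_dual M" by (rule poc_set_dual)
  have UH: "U \<subseteq> clopen_half_spaces M" using D.ultra_filter_subset[OF U] by simp
  have meet: "H \<inter> K \<noteq> {}" if HK: "H \<in> U" "K \<in> U" for H K
  proof
    assume "H \<inter> K = {}"
    have H: "H \<in> clopen_half_spaces M" and K: "K \<in> clopen_half_spaces M" using HK UH by auto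
    have "(H, sma_carrier M - K) \<in> poc_le (sma_dual M)"
      using H K \<open>H \<inter> K = {}\<close> clopen_half_space_subset[OF H] by (auto simp: clopen_half_space_compl)
    then have "sma_carrier M - K \<in> U" using D.ultra_filter_upward[OF U HK(1)] by blast
    then show False using D.ultra_filter_star[OF U, of K] K HK by simp
  qed
  have "\<forall>H\<in>U. closedin (sma_top M) H" using UH by (auto simp: clopen_half_spaces_def)
  moreover have "\<Inter>\<F> \<noteq> {}" if "finite \<F>" "\<F> \<subseteq> U" for \<F>
  proof (cases "\<F> = {}")
    case False
    have "(\<Inter>H\<in>\<F>. H) \<noteq> {}"
      using \<open>finite \<F>\<close> False
    proof (rule Helly)
      show "median_convex (sma_carrier M) (sma_med M) H" if "H \<in> \<F>" for H
        using that \<open>\<F> \<subseteq> U\<close> UH by (auto simp: clopen_half_spaces_def half_space_def)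
      show "H \<inter> K \<noteq> {}" if "H \<in> \<F>" "K \<in> \<F>" for H K
        using that \<open>\<F> \<subseteq> U\<close> by (intro meet) auto
    qed
    then show ?thesis by simp
  qed simp
  moreover have "compact_space (sma_top M)" using Stone_space by (simp add: Stone_space_def)
  ultimately have "\<Inter>U \<noteq> {}"
    using spec[OF iffD1[OF compact_space_fip], of "sma_top M" U] by simp
  then obtain x where x: "\<And>H. H \<in> U \<Longrightarrow> x \<in> H" by blast
  have "sma_carrier M \<in> U"
    using D.ultra_filter_star[OF U D.zero_closed] D.zero_notin_ultra_filter[OF U] by simp
  then have xM: "x \<in> sma_carrier M" by (rule x)
  moreover have "U \<subseteq> sma_ev M x" using x xM UH by (auto simp: sma_ev_apply)
  then have "U = sma_ev M x" using U sma_ev_ultra_filter[OF xM] by (intro D.ultra_filter_eqI)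
  ultimately show thesis using that by blast
qed

lemma sma_ev_iso: "sma_ev M \<in> sma_iso M (poc_dual (sma_dual M))"
proof (rule sma_isoI)
  interpret D: poc_set "sma_dual M" by (rule poc_set_dual)
  show "stone_median_algebra M" by (rule stone_median_algebra_axioms)
  show "stone_median_algebra (poc_dual (sma_dual M))" by (rule D.stone_median_algebra_dual)
  show "sma_ev M \<in> sma_hom M (poc_dual (sma_dual M))" by (rule sma_ev_hom)
  show "sma_ev M ` sma_carrier M = sma_carrier (poc_dual (sma_dual M))"
  proof (rule set_eqI, rule iffI)
    fix U assume "U \<in> sma_carrier (poc_dual (sma_dual M))"
    then have "U \<in> ultra_filters (sma_dual M)" by simp
    then obtain x where "x \<in> sma_carrier M" "sma_ev M x = U" by (rule sma_ev_onto)
    then show "U \<in> sma_ev M ` sma_carrier M" by blast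
  qed (use sma_ev_ultra_filter in auto)
  show "inj_on (sma_ev M) (sma_carrier M)"
  proof (rule inj_onI, rule ccontr)
    fix x y assume xy: "x \<in> sma_carrier M" "y \<in> sma_carrier M" "sma_ev M x = sma_ev M y" "x \<noteq> y"
    then obtain H where "H \<in> clopen_half_spaces M" "x \<in> H" "y \<notin> H"
      using clopen_half_space_separation by blast
    then show False using xy by (auto simp: sma_ev_apply)
  qed
qed

end

lemma sma_ev_natural:
  assumes M: "stone_median_algebra M" and N: "stone_median_algebra N" and f: "f \<in> sma_hom M N"
  shows "compose (sma_carrier M) (sma_ev N) f =
    compose (sma_carrier M) (poc_dual_map (sma_dual N) (sma_dual M) (sma_dual_map M N f)) (sma_ev M)"
proof
  fix x
  show "compose (sma_carrier M) (sma_ev N) f x =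
    compose (sma_carrier M) (poc_dual_map (sma_dual N) (sma_dual M) (sma_dual_map M N f)) (sma_ev M) x"
  proof (cases "x \<in> sma_carrier M")
    case True
    have "sma_dual_map M N f H \<in> sma_ev M x \<longleftrightarrow> f x \<in> H" if "H \<in> clopen_half_spaces N" for H
      using True clopen_half_space_vimage[OF M f that]
      by (simp add: stone_median_algebra.sma_ev_apply[OF M] sma_dual_map_apply[OF that])
    then show ?thesis
      using True stone_median_algebra.sma_ev_ultra_filter[OF M True] sma_homD(1)[OF f True]
      by (auto simp: compose_def poc_dual_map_apply stone_median_algebra.sma_ev_apply[OF N])
  qed (simp add: compose_def)
qed

section \<open>The duality\<close>

theorem theorem5p3:
  shows
    "\<comment> \<open>\<open>P \<mapsto> P\<^sup>\<circ>\<close> is a contravariant functor from poc sets to Stone median algebras\<close>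
     (\<forall>P :: 'p poc. poc_set P \<longrightarrow> stone_median_algebra (poc_dual P)) \<and>
     (\<forall>(P :: 'p poc) (Q :: 'q poc) f. poc_set P \<and> poc_set Q \<and> f \<in> poc_hom P Q \<longrightarrow>
        poc_dual_map P Q f \<in> sma_hom (poc_dual Q) (poc_dual P)) \<and>
     (\<forall>P :: 'p poc. poc_set P \<longrightarrow> poc_dual_map P P (poc_id P) = sma_id (poc_dual P)) \<and>
     (\<forall>(P :: 'p poc) (Q :: 'q poc) (R :: 'r poc) f g.
        poc_set P \<and> poc_set Q \<and> poc_set R \<and> f \<in> poc_hom P Q \<and> g \<in> poc_hom Q R \<longrightarrow>
        poc_dual_map P R (compose (poc_carrier P) g f) =
          compose (sma_carrier (poc_dual R)) (poc_dual_map P Q f) (poc_dual_map Q R g)) \<and>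
     \<comment> \<open>\<open>M \<mapsto> M\<^sup>\<bullet>\<close> is a contravariant functor from Stone median algebras to poc sets\<close>
     (\<forall>M :: 'm topological_median. stone_median_algebra M \<longrightarrow> poc_set (sma_dual M)) \<and>
     (\<forall>(M :: 'm topological_median) (N :: 'n topological_median) f.
        stone_median_algebra M \<and> stone_median_algebra N \<and> f \<in> sma_hom M N \<longrightarrow>
        sma_dual_map M N f \<in> poc_hom (sma_dual N) (sma_dual M)) \<and>
     (\<forall>M :: 'm topological_median. stone_median_algebra M \<longrightarrow>
        sma_dual_map M M (sma_id M) = poc_id (sma_dual M)) \<and>
     (\<forall>(M :: 'm topological_median) (N :: 'n topological_median) (K :: 'k topological_median) f g.
        stone_median_algebra M \<and> stone_median_algebra N \<and> stone_median_algebra K \<and>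
        f \<in> sma_hom M N \<and> g \<in> sma_hom N K \<longrightarrow>
        sma_dual_map M K (compose (sma_carrier M) g f) =
          compose (poc_carrier (sma_dual K)) (sma_dual_map M N f) (sma_dual_map N K g)) \<and>
     \<comment> \<open>evaluation \<open>P \<rightarrow> P\<^sup>\<circ>\<^sup>\<bullet>\<close> is a natural isomorphism of poc sets\<close>
     (\<forall>P :: 'p poc. poc_set P \<longrightarrow> poc_ev P \<in> poc_iso P (sma_dual (poc_dual P))) \<and>
     (\<forall>(P :: 'p poc) (Q :: 'q poc) f. poc_set P \<and> poc_set Q \<and> f \<in> poc_hom P Q \<longrightarrow>
        compose (poc_carrier P) (poc_ev Q) f =
        compose (poc_carrier P)
          (sma_dual_map (poc_dual Q) (poc_dual P) (poc_dual_map P Q f)) (poc_ev P)) \<and>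
     \<comment> \<open>evaluation \<open>M \<rightarrow> M\<^sup>\<bullet>\<^sup>\<circ>\<close> is a natural isomorphism of Stone median algebras\<close>
     (\<forall>M :: 'm topological_median. stone_median_algebra M \<longrightarrow>
        sma_ev M \<in> sma_iso M (poc_dual (sma_dual M))) \<and>
     (\<forall>(M :: 'm topological_median) (N :: 'n topological_median) f.
        stone_median_algebra M \<and> stone_median_algebra N \<and> f \<in> sma_hom M N \<longrightarrow>
        compose (sma_carrier M) (sma_ev N) f =
        compose (sma_carrier M)
          (poc_dual_map (sma_dual N) (sma_dual M) (sma_dual_map M N f)) (sma_ev M))"
  by (intro conjI allI impI; (elim conjE)?)
    (simp_all add: poc_set.stone_median_algebra_dual poc_dual_map_hom poc_dual_map_id
      poc_dual_map_compose stone_median_algebra.poc_set_dual sma_dual_map_hom sma_dual_map_id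
      sma_dual_map_compose poc_set.poc_ev_iso poc_ev_natural stone_median_algebra.sma_ev_iso
      sma_ev_natural)

end
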